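(* Let $X$ be a Hilbert $C^*$-module over a $C^*$-algebra $\mathsf{A}$, and let $(E_N)_{N\in\mathbb{N}}$ be a sequence that is an increasing approximate unit for $\mathbb{K}(X)$. (a) There exist a sequence $(x_n)_n$ in $X$ and an increasing sequence of natural numbers $p(1)<p(2)<\cdots$ such that for all $N\in\mathbb{N}$ $$\sum_{n=1}^{p(N)}\theta_{x_n,x_n}\le E_N\quad\text{and}\quad \left\|\sum_{n=1}^{p(N)}\theta_{x_n,x_n}-E_N\right\|<\frac1N.$$ (b) If $(x_n)_n$ is any sequence in $X$ for which there is an increasing sequence of natural numbers $p(1)<p(2)<\cdots$ such that $\sum_{n=1}^{p(N)}\theta_{x_n,x_n}\le E_N$ and $\left\|\sum_{n=1}^{p(N)}\theta_{x_n,x_n}-E_N\right\|<\frac1N$ for all $N\in\mathbb{N}$, then $(x_n)_n$ is a Parseval frame for $X$.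
   Context: $\mathsf{A}$ is an arbitrary $C^*$-algebra (not necessarily unital). Hilbert $\mathsf{A}$-modules are right modules with $\mathsf{A}$-valued inner product that is $\mathsf{A}$-linear in the second variable; they are not assumed to be full. For $x,y\in X$, $\theta_{y,x}$ is the adjointable operator on $X$ given by $\theta_{y,x}(z)=y\langle x,z\rangle$; $\mathbb{K}(X)$ is the norm closure of the linear span of all $\theta_{y,x}$. An approximate unit for a $C^*$-algebra $\mathsf{B}$ is a net $(e_\lambda)_\lambda$ of positive elements of the closed unit ball of $\mathsf{B}$ with $\lim_\lambda e_\lambda b=b$ for all $b\in\mathsf{B}$; it is increasing if $e_\lambda\le e_\mu$ whenever $\lambda\le\mu$. A sequence $(x_n)_n$ in $X$ is a Parseval frame for $X$ if $\sum_{n=1}^{\infty}\langle x,x_n\rangle\langle x_n,x\rangle=\langle x,x\rangle$ for all $x\in X$, with norm convergence of the series. *)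

theory Defs
  imports "HOL-Analysis.Analysis"
begin

text \<open>Complex vector spaces, built on top of the real hierarchy of the library.\<close>

class scaleC =
  fixes scaleC :: "complex \<Rightarrow> 'a \<Rightarrow> 'a"  (infixr \<open>*\<^sub>C\<close> 75)

class complex_vector = real_vector + scaleC +
  assumes scaleC_add_right: "a *\<^sub>C (x + y) = a *\<^sub>C x + a *\<^sub>C y"
    and scaleC_add_left: "(a + b) *\<^sub>C x = a *\<^sub>C x + b *\<^sub>C x"
    and scaleC_scaleC: "a *\<^sub>C (b *\<^sub>C x) = (a * b) *\<^sub>C x"
    and scaleR_scaleC: "r *\<^sub>R x = complex_of_real r *\<^sub>C x"

class complex_normed_vector = complex_vector + real_normed_vector +
  assumes norm_scaleC: "norm (a *\<^sub>C x) = cmod a * norm x"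

global_interpretation complex_vector: vector_space "scaleC :: complex \<Rightarrow> 'a \<Rightarrow> 'a::complex_vector"
proof
  show "1 *\<^sub>C x = x" for x :: 'a
    using scaleR_scaleC[of 1 x] by simp
qed (simp_all add: scaleC_add_right scaleC_add_left scaleC_scaleC)

lemma bounded_linear_scaleC: "bounded_linear (\<lambda>x::'a::complex_normed_vector. c *\<^sub>C x)"
  by (rule bounded_linear_intro[where K = "cmod c"])
    (simp_all add: scaleC_add_right scaleR_scaleC scaleC_scaleC norm_scaleC mult.commute)

instantiation blinfun :: (real_normed_vector, complex_normed_vector) complex_vector
begin

lift_definition scaleC_blinfun :: "complex \<Rightarrow> 'a \<Rightarrow>\<^sub>L 'b \<Rightarrow> 'a \<Rightarrow>\<^sub>L 'b"
  is "\<lambda>c f x. c *\<^sub>C f x"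
  by (rule bounded_linear_compose[OF bounded_linear_scaleC])

instance
  by (standard; transfer)
    (simp_all add: fun_eq_iff scaleC_add_right scaleC_add_left scaleC_scaleC scaleR_scaleC)

end

text \<open>C*-algebras; the class \<^class>\<open>real_normed_algebra\<close> requires no unit.\<close>

class cstar_algebra = complex_normed_vector + real_normed_algebra + banach +
  fixes star :: "'a \<Rightarrow> 'a"
  assumes mult_scaleC_left: "(c *\<^sub>C a) * b = c *\<^sub>C (a * b)"
    and mult_scaleC_right: "a * (c *\<^sub>C b) = c *\<^sub>C (a * b)"
    and star_star: "star (star a) = a"
    and star_add: "star (a + b) = star a + star b"
    and star_scaleC: "star (c *\<^sub>C a) = cnj c *\<^sub>C star a"
    and star_mult: "star (a * b) = star b * star a"
    and cstar_identity: "norm (star a * a) = (norm a)\<^sup>2"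

definition cstar_positive :: "'a::cstar_algebra \<Rightarrow> bool" where
  "cstar_positive a \<longleftrightarrow> (\<exists>b. a = star b * b)"

text \<open>
  The module is a whole type, which carries its norm as a type class operation; the norm is tied to
  the inner product by \<open>norm_eq_sqrt_ip\<close>, and completeness is the class \<^class>\<open>banach\<close>.
\<close>

locale hilbert_module =
  fixes act :: "'x::{complex_normed_vector,banach} \<Rightarrow> 'a::cstar_algebra \<Rightarrow> 'x"
    and ip :: "'x \<Rightarrow> 'x \<Rightarrow> 'a"
  assumes act_add_left: "act (x + y) a = act x a + act y a"
    and act_add_right: "act x (a + b) = act x a + act x b"
    and act_act: "act (act x a) b = act x (a * b)"
    and act_scaleC_left: "act (c *\<^sub>C x) a = c *\<^sub>C act x a"
    and act_scaleC_right: "act x (c *\<^sub>C a) = c *\<^sub>C act x a"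
    and ip_add_right: "ip x (y + z) = ip x y + ip x z"
    and ip_scaleC_right: "ip x (c *\<^sub>C y) = c *\<^sub>C ip x y"
    and ip_act_right: "ip x (act y a) = ip x y * a"
    and star_ip: "star (ip x y) = ip y x"
    and ip_positive: "cstar_positive (ip x x)"
    and ip_definite: "ip x x = 0 \<Longrightarrow> x = 0"
    and norm_eq_sqrt_ip: "norm x = sqrt (norm (ip x x))"

text \<open>
  Operators on the module are elements of the Banach space of bounded real-linear maps with the
  operator norm. That \<open>\<theta>\<close> is bounded, so that \<^const>\<open>Blinfun\<close> is harmless here, is
  lemma \<open>theta_apply\<close> below.
\<close>

definition theta ::
  "('x \<Rightarrow> 'a \<Rightarrow> 'x) \<Rightarrow> ('x \<Rightarrow> 'x \<Rightarrow> 'a) \<Rightarrow> 'x \<Rightarrow> 'x \<Rightarrow> 'x::real_normed_vector \<Rightarrow>\<^sub>L 'x" where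
  "theta act ip y x = Blinfun (\<lambda>z. act y (ip x z))"

definition compacts ::
  "('x \<Rightarrow> 'a \<Rightarrow> 'x) \<Rightarrow> ('x \<Rightarrow> 'x \<Rightarrow> 'a) \<Rightarrow> ('x::complex_normed_vector \<Rightarrow>\<^sub>L 'x) set" where
  "compacts act ip = closure (complex_vector.span {theta act ip y x | y x. True})"

definition is_adjoint ::
  "('x \<Rightarrow> 'x \<Rightarrow> 'a) \<Rightarrow> ('x::real_normed_vector \<Rightarrow>\<^sub>L 'x) \<Rightarrow> ('x \<Rightarrow>\<^sub>L 'x) \<Rightarrow> bool" where
  "is_adjoint ip T S \<longleftrightarrow> (\<forall>x y. ip (T x) y = ip x (S y))"

text \<open>Positivity and order in the C*-algebra of compact operators; cf. \<^const>\<open>cstar_positive\<close>.\<close>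

definition compact_positive ::
  "('x \<Rightarrow> 'a \<Rightarrow> 'x) \<Rightarrow> ('x \<Rightarrow> 'x \<Rightarrow> 'a) \<Rightarrow> ('x::complex_normed_vector \<Rightarrow>\<^sub>L 'x) \<Rightarrow> bool" where
  "compact_positive act ip T \<longleftrightarrow>
     (\<exists>S\<in>compacts act ip. \<exists>S'\<in>compacts act ip. is_adjoint ip S S' \<and> T = S' o\<^sub>L S)"

definition compact_le ::
  "('x \<Rightarrow> 'a \<Rightarrow> 'x) \<Rightarrow> ('x \<Rightarrow> 'x \<Rightarrow> 'a) \<Rightarrow> ('x::complex_normed_vector \<Rightarrow>\<^sub>L 'x) \<Rightarrow> ('x \<Rightarrow>\<^sub>L 'x) \<Rightarrow> bool" where
  "compact_le act ip S T \<longleftrightarrow>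
     S \<in> compacts act ip \<and> T \<in> compacts act ip \<and> compact_positive act ip (T - S)"

text \<open>All sequences are indexed by \<open>1, 2, \<dots>\<close>; their value at \<open>0\<close> is irrelevant.\<close>

definition increasing_approx_unit ::
  "('x \<Rightarrow> 'a \<Rightarrow> 'x) \<Rightarrow> ('x \<Rightarrow> 'x \<Rightarrow> 'a) \<Rightarrow> (nat \<Rightarrow> 'x::complex_normed_vector \<Rightarrow>\<^sub>L 'x) \<Rightarrow> bool" where
  "increasing_approx_unit act ip E \<longleftrightarrow>
     (\<forall>N\<ge>1. E N \<in> compacts act ip \<and> compact_positive act ip (E N) \<and> norm (E N) \<le> 1) \<and>
     (\<forall>T\<in>compacts act ip. (\<lambda>N. E N o\<^sub>L T) \<longlonglongrightarrow> T) \<and>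
     (\<forall>M\<ge>1. \<forall>N\<ge>M. compact_le act ip (E M) (E N))"

definition parseval_frame :: "('x \<Rightarrow> 'x \<Rightarrow> 'a::real_normed_algebra) \<Rightarrow> (nat \<Rightarrow> 'x) \<Rightarrow> bool" where
  "parseval_frame ip x \<longleftrightarrow>
     (\<forall>v. (\<lambda>n. ip v (x (Suc n)) * ip (x (Suc n)) v) sums ip v v)"

context hilbert_module
begin

lemma ip_add_left: "ip (x + y) z = ip x z + ip y z"
  by (metis ip_add_right star_add star_ip)

lemma ip_scaleC_left: "ip (c *\<^sub>C x) y = cnj c *\<^sub>C ip x y"
  by (metis ip_scaleC_right star_scaleC star_ip)

lemma norm_ip_self: "norm (ip x x) = (norm x)\<^sup>2"
  by (simp add: norm_eq_sqrt_ip)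

lemma ip_polarization:
  "4 *\<^sub>C ip x z = ip (x + z) (x + z) + (-1) *\<^sub>C ip (x + (-1) *\<^sub>C z) (x + (-1) *\<^sub>C z)
     + (-\<i>) *\<^sub>C ip (x + \<i> *\<^sub>C z) (x + \<i> *\<^sub>C z)
     + \<i> *\<^sub>C ip (x + (-\<i>) *\<^sub>C z) (x + (-\<i>) *\<^sub>C z)"
proof -
  have four: "4 *\<^sub>C ip x z = ip x z + ip x z + ip x z + ip x z"
    using scaleC_add_left[of 2 2 "ip x z"] scaleC_add_left[of 1 1 "ip x z"] by simp
  show ?thesis
    unfolding four ip_add_left ip_add_right ip_scaleC_left ip_scaleC_right
    by (simp add: scaleC_add_right scaleC_scaleC complex_vector.scale_right_diff_distrib)
qed

lemma norm_ip_le_unit: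
  assumes "norm x \<le> 1" "norm z \<le> 1"
  shows "norm (ip x z) \<le> 4"
proof -
  have b: "norm (c *\<^sub>C ip (x + d *\<^sub>C z) (x + d *\<^sub>C z)) \<le> 4" if "cmod c = 1" "cmod d = 1" for c d
  proof -
    have "norm (x + d *\<^sub>C z) \<le> norm x + norm (d *\<^sub>C z)"
      by (rule norm_triangle_ineq)
    also have "\<dots> \<le> 2" using assms that by (simp add: norm_scaleC)
    finally have "(norm (x + d *\<^sub>C z))\<^sup>2 \<le> 2\<^sup>2" by (intro power_mono) auto
    then show ?thesis using that by (simp add: norm_scaleC norm_ip_self)
  qed
  have "4 * norm (ip x z) = norm (4 *\<^sub>C ip x z)" by (simp add: norm_scaleC)
  also have "\<dots> \<le> 4 + 4 + 4 + 4"
    unfolding ip_polarization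
    using b[of 1 1] b[of "-1" "-1"] b[of "-\<i>" \<i>] b[of \<i> "-\<i>"]
    by (intro norm_triangle_mono) auto
  finally show ?thesis by simp
qed

lemma norm_ip_le: "norm (ip x z) \<le> 4 * norm x * norm z"
proof (cases "x = 0 \<or> z = 0")
  case True
  moreover have "ip x 0 = 0" for x using ip_add_right[of x 0 0] by simp
  moreover have "ip 0 x = 0" for x using ip_add_left[of 0 0 x] by simp
  ultimately show ?thesis by auto
next
  case False
  let ?a = "complex_of_real (inverse (norm x))" and ?b = "complex_of_real (inverse (norm z))"
  have "norm (ip (?a *\<^sub>C x) (?b *\<^sub>C z)) \<le> 4"
    using False by (intro norm_ip_le_unit) (simp_all add: norm_scaleC norm_inverse)
  then show ?thesis
    using False
    by (simp add: ip_scaleC_left ip_scaleC_right norm_scaleC norm_inverse norm_mult norm_divide field_simps)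
qed

lemma norm_act_le: "norm (act x a) \<le> norm x * norm a"
proof -
  have "ip (act x a) (act x a) = star a * ip x x * a"
    by (metis ip_act_right star_ip star_mult)
  then have "(norm (act x a))\<^sup>2 \<le> norm (star a) * norm (ip x x) * norm a"
    using norm_mult_ineq[of "star a * ip x x" a]
      mult_right_mono[OF norm_mult_ineq[of "star a" "ip x x"] norm_ge_zero[of a]]
    by (simp add: norm_ip_self[symmetric])
  moreover have "norm (star a) = norm a"
  proof -
    have le: "norm b \<le> norm (star b)" for b :: 'a
    proof (cases "b = 0")
      case False
      have "norm b * norm b \<le> norm (star b) * norm b"
        using cstar_identity[of b] norm_mult_ineq[of "star b" b] by (simp add: power2_eq_square)
      then show ?thesis using False by simp
    qed simp
    show ?thesis using le[of a] le[of "star a"] by (simp add: star_star)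
  qed
  ultimately have "(norm (act x a))\<^sup>2 \<le> (norm x * norm a)\<^sup>2"
    by (simp add: norm_ip_self power2_eq_square algebra_simps)
  then show ?thesis by (rule power2_le_imp_le) simp
qed

lemma theta_apply [simp]: "theta act ip y x z = act y (ip x z)"
proof -
  have "norm (act y (ip x w)) \<le> norm w * (norm y * (4 * norm x))" for w
    using norm_act_le[of y "ip x w"] mult_left_mono[OF norm_ip_le[of x w], of "norm y"]
    by (simp add: algebra_simps)
  then have "bounded_linear (\<lambda>z. act y (ip x z))"
    by (intro bounded_linear_intro)
      (simp_all add: ip_add_right act_add_right scaleR_scaleC ip_scaleC_right act_scaleC_right)
  then show ?thesis by (simp add: theta_def bounded_linear_Blinfun_apply)
qed

end

end

theory Submission
  imports Defs
begin

text \<open>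
  In (a), a positive compact \<open>T = r\<^sup>2\<close> is approximated from below by \<open>r F r = \<Sum>\<theta>\<^bsub>rz,rz\<^esub>\<close>, where
  \<open>F = \<Sum>\<theta>\<^bsub>z,z\<^esub> \<le> 1\<close> almost fixes \<open>r\<close>. Such an \<open>F\<close> is \<open>1 - (1 - h)\<^sup>k = \<Sum>\<^bsub>j<k\<^esub> (1 - h)\<^sup>j h\<close> for large
  \<open>k\<close>, with \<open>h = \<Sum>\<theta>\<^bsub>a,a\<^esub> \<le> 1\<close>, and applying this to \<open>E\<^bsub>N+1\<^esub> - \<Sum>\<^bsub>n\<le>p(N)\<^esub> \<theta>\<^bsub>x\<^sub>n,x\<^sub>n\<^esub> \<ge> 0\<close> gives the
  next block of vectors. In (b), \<open>E\<^sub>N v \<rightarrow> v\<close> makes the partial sums of the frame series converge along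
  the subsequence \<open>p(N)\<close>, and being increasing they converge.

  Positivity is expressed without spectral theory: \<open>a \<ge> 0\<close> means that \<open>a\<close> is self-adjoint with
  \<open>\<parallel>t - a\<parallel> \<le> t\<close> for some \<open>t\<close>. This is visibly a convex cone, and square roots come from an iteration.
  The results are used twice: for the algebra acting on itself by left multiplication, where they
  yield the Cauchy-Schwarz inequality of general Hilbert modules, and then for the operators on the
  module.
\<close>

section \<open>The Banach algebra of bounded operators\<close>

text \<open>
  A copy of \<^typ>\<open>'a \<Rightarrow>\<^sub>L 'a\<close> with composition as multiplication. It is not made an instance of
  \<^class>\<open>real_normed_algebra_1\<close>, because \<open>0 \<noteq> 1\<close> fails on the trivial space.
\<close>

typedef (overloaded) ('a::real_normed_vector) endo = "UNIV :: ('a \<Rightarrow>\<^sub>L 'a) set"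
  morphisms op_of Endo ..

setup_lifting type_definition_endo

instantiation endo :: (real_normed_vector) "{real_vector, ring, monoid_mult}"
begin

lift_definition zero_endo :: "'a endo" is 0 .
lift_definition plus_endo :: "'a endo \<Rightarrow> 'a endo \<Rightarrow> 'a endo" is "(+)" .
lift_definition minus_endo :: "'a endo \<Rightarrow> 'a endo \<Rightarrow> 'a endo" is "(-)" .
lift_definition uminus_endo :: "'a endo \<Rightarrow> 'a endo" is uminus .
lift_definition scaleR_endo :: "real \<Rightarrow> 'a endo \<Rightarrow> 'a endo" is scaleR .
lift_definition times_endo :: "'a endo \<Rightarrow> 'a endo \<Rightarrow> 'a endo" is "(o\<^sub>L)" .
lift_definition one_endo :: "'a endo" is id_blinfun .

instance
proof
  fix a b c :: "'a endo"
  show "a + b + c = a + (b + c)" "a + b = b + a" "0 + a = a" "- a + a = 0" "a - b = a + - b"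
    by (transfer; simp)+
  show "a * b * c = a * (b * c)" "1 * a = a" "a * 1 = a"
    by (transfer; simp add: blinfun_eqI)+
  show "(a + b) * c = a * c + b * c" "a * (b + c) = a * b + a * c"
    by (transfer; simp add: blinfun_eqI blinfun.add_left blinfun.add_right)+
  fix r s :: real
  show "r *\<^sub>R (a + b) = r *\<^sub>R a + r *\<^sub>R b" "(r + s) *\<^sub>R a = r *\<^sub>R a + s *\<^sub>R a"
    "r *\<^sub>R s *\<^sub>R a = (r * s) *\<^sub>R a" "1 *\<^sub>R a = a"
    by (transfer; simp add: scaleR_add_right scaleR_add_left)+
qed

end

instantiation endo :: (real_normed_vector) real_normed_algebra
begin

lift_definition norm_endo :: "'a endo \<Rightarrow> real" is norm .

definition dist_endo :: "'a endo \<Rightarrow> 'a endo \<Rightarrow> real"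
  where "dist_endo a b = norm (a - b)"

definition sgn_endo :: "'a endo \<Rightarrow> 'a endo"
  where "sgn_endo a = a /\<^sub>R norm a"

definition uniformity_endo :: "('a endo \<times> 'a endo) filter"
  where "uniformity_endo = (INF e\<in>{0 <..}. principal {(x, y). dist x y < e})"

definition open_endo :: "'a endo set \<Rightarrow> bool"
  where "open_endo S = (\<forall>x\<in>S. \<forall>\<^sub>F (x', y) in uniformity. x' = x \<longrightarrow> y \<in> S)"

instance
proof
  fix a b c :: "'a endo" and r :: real
  show "norm (a + b) \<le> norm a + norm b" by transfer (rule norm_triangle_ineq)
  show "norm (r *\<^sub>R a) = \<bar>r\<bar> * norm a" by transfer simp
  show "norm a = 0 \<longleftrightarrow> a = 0" by transfer simp
  show "norm (a * b) \<le> norm a * norm b" by transfer (rule norm_blinfun_compose)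
  show "r *\<^sub>R a * b = r *\<^sub>R (a * b)" "a * r *\<^sub>R b = r *\<^sub>R (a * b)"
    by (transfer; simp add: blinfun.scaleR_left blinfun.scaleR_right blinfun_eqI)+
qed (rule dist_endo_def sgn_endo_def uniformity_endo_def open_endo_def)+

end

lemma op_of_simps [simp]:
  "op_of (a + b) = op_of a + op_of b" "op_of (a - b) = op_of a - op_of b"
  "op_of (- a) = - op_of a" "op_of (r *\<^sub>R a) = r *\<^sub>R op_of a"
  "op_of (a * b) = op_of a o\<^sub>L op_of b" "op_of 0 = 0" "op_of 1 = id_blinfun"
  by (transfer; simp)+

lemma norm_op_of: "norm (op_of a) = norm a"
  by transfer simp

lemma op_of_Endo [simp]: "op_of (Endo f) = f"
  by (simp add: Endo_inverse)

lemma endo_eqI: "(\<And>x. op_of a x = op_of b x) \<Longrightarrow> a = b"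
  by (metis blinfun_eqI op_of_inject)

lemma bounded_linear_op_of: "bounded_linear op_of"
  by (rule bounded_linear_intro[where K = 1]) (simp_all add: norm_op_of)

lemma bounded_linear_Endo: "bounded_linear Endo"
  by (rule bounded_linear_intro[where K = 1])
    (simp_all add: norm_op_of[symmetric] op_of_inject[symmetric])

instance endo :: (banach) banach
proof
  fix X :: "nat \<Rightarrow> 'a endo"
  assume "Cauchy X"
  then have "Cauchy (\<lambda>n. op_of (X n))"
    by (rule bounded_linear.Cauchy[OF bounded_linear_op_of])
  then obtain f where "(\<lambda>n. op_of (X n)) \<longlonglongrightarrow> f"
    by (meson Cauchy_convergent_iff convergent_def)
  then have "X \<longlonglongrightarrow> Endo f"
    using bounded_linear.tendsto[OF bounded_linear_Endo] by (fastforce simp: op_of_inverse)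
  then show "convergent X" by (rule convergentI)
qed

section \<open>Positivity in an abstract C*-algebra\<close>

text \<open>A limit \<open>y\<close> satisfies 2y = a + y^2, hence (1 - y)^2 = 1 - a. Square roots
  thus come from a convergent iteration.\<close>

primrec sqrt_iter :: "'e::real_algebra \<Rightarrow> nat \<Rightarrow> 'e" where
  "sqrt_iter a 0 = 0"
| "sqrt_iter a (Suc n) = (1/2) *\<^sub>R (a + sqrt_iter a n * sqrt_iter a n)"

lemma sqrt_iter_real_bounds: "0 \<le> sqrt_iter (1::real) n \<and> sqrt_iter (1::real) n \<le> 1"
proof (induction n)
  case (Suc n)
  then have "sqrt_iter (1::real) n * sqrt_iter 1 n \<le> 1" by (simp add: mult_le_one)
  then show ?case by simp
qed simp

lemma sqrt_iter_real_mono: "sqrt_iter (1::real) n \<le> sqrt_iter 1 (Suc n)"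
proof -
  have "0 \<le> (1 - sqrt_iter (1::real) n)\<^sup>2" by simp
  then show ?thesis by (simp add: power2_eq_square algebra_simps)
qed

text \<open>The limit solves (l - 1)^2 = 0. Its existence makes the scalar increments, which serve
  as majorants below, summable.\<close>

lemma sqrt_iter_real_tendsto: "sqrt_iter (1::real) \<longlonglongrightarrow> 1"
proof -
  have "incseq (sqrt_iter (1::real))"
    unfolding incseq_Suc_iff using sqrt_iter_real_mono by blast
  then obtain l where l: "sqrt_iter (1::real) \<longlonglongrightarrow> l"
    using incseq_convergent[of "sqrt_iter (1::real)" 1] sqrt_iter_real_bounds by metis
  have "(\<lambda>n. sqrt_iter (1::real) (Suc n)) \<longlonglongrightarrow> (1/2) *\<^sub>R (1 + l * l)"
    unfolding sqrt_iter.simps by (intro tendsto_intros l)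
  then have "l = (1/2) *\<^sub>R (1 + l * l)"
    using LIMSEQ_unique[OF LIMSEQ_Suc[OF l]] by blast
  then have "(l - 1) * (l - 1) = 0" by (simp add: algebra_simps)
  then show ?thesis using l by simp
qed

lemma sqrt_iter_commute: "b * a = a * b \<Longrightarrow> b * sqrt_iter a n = sqrt_iter a n * b"
proof (induction n)
  case (Suc n)
  then have "b * (sqrt_iter a n * sqrt_iter a n) = sqrt_iter a n * sqrt_iter a n * b"
    by (metis mult.assoc)
  then show ?case using Suc by (simp add: distrib_left distrib_right)
qed simp

lemma norm_sqrt_iter_le:
  assumes "norm (a::'e::real_normed_algebra) \<le> 1"
  shows "norm (sqrt_iter a n) \<le> sqrt_iter 1 n"
proof (induction n)
  case (Suc n)
  have "norm (sqrt_iter a n * sqrt_iter a n) \<le> sqrt_iter 1 n * sqrt_iter 1 n"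
    using Suc by (intro order_trans[OF norm_mult_ineq] mult_mono) (auto simp: sqrt_iter_real_bounds)
  then show ?case using assms norm_triangle_ineq[of a "sqrt_iter a n * sqrt_iter a n"] by simp
qed simp

text \<open>The scalar iteration dominates the increments, hence convergence for all \<open>\<parallel>a\<parallel> \<le> 1\<close>.\<close>

lemma norm_sqrt_iter_diff_le:
  assumes "norm (a::'e::real_normed_algebra) \<le> 1"
  shows "norm (sqrt_iter a (Suc n) - sqrt_iter a n) \<le> sqrt_iter 1 (Suc n) - sqrt_iter 1 n"
proof (induction n)
  case 0
  show ?case using assms by simp
next
  case (Suc n)
  let ?y = "sqrt_iter a n" and ?z = "sqrt_iter a (Suc n)"
  let ?s = "sqrt_iter (1::real) n" and ?t = "sqrt_iter (1::real) (Suc n)"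
  \<comment> \<open>The difference of squares below factors because both iterates are polynomials in
    \<open>a\<close> and so commute.\<close>
  have comm: "?y * ?z = ?z * ?y"
    by (intro sqrt_iter_commute) (rule sqrt_iter_commute[symmetric], simp)
  have "sqrt_iter a (Suc (Suc n)) - ?z = (1/2) *\<^sub>R (?z * ?z - ?y * ?y)"
    using sqrt_iter.simps(2)[of a "Suc n"] sqrt_iter.simps(2)[of a n]
    by (simp only: scaleR_diff_right[symmetric]) simp
  also have "?z * ?z - ?y * ?y = (?z + ?y) * (?z - ?y)"
    using comm by (simp only: distrib_right right_diff_distrib) simp
  finally have "norm (sqrt_iter a (Suc (Suc n)) - ?z) = (1/2) * norm ((?z + ?y) * (?z - ?y))"
    by simp
  also have "\<dots> \<le> (1/2) * ((?t + ?s) * (?t - ?s))"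
    by (intro mult_left_mono order_trans[OF norm_mult_ineq] mult_mono Suc.IH
        order_trans[OF norm_triangle_ineq] add_mono norm_sqrt_iter_le assms add_nonneg_nonneg)
      (use sqrt_iter_real_bounds in auto)
  also have "\<dots> = sqrt_iter 1 (Suc (Suc n)) - ?t"
    using sqrt_iter.simps(2)[of "1::real" "Suc n"] sqrt_iter.simps(2)[of "1::real" n]
    by (simp only: algebra_simps) (simp add: algebra_simps)
  finally show ?case .
qed

lemma sqrt_iter_convergent:
  assumes "norm (a::'e::{real_normed_algebra,banach}) \<le> 1"
  shows "convergent (sqrt_iter a)"
proof -
  have "summable (\<lambda>n. sqrt_iter (1::real) (Suc n) - sqrt_iter 1 n)"
    using telescope_sums[OF sqrt_iter_real_tendsto] by (rule sums_summable)
  then have "summable (\<lambda>n. sqrt_iter a (Suc n) - sqrt_iter a n)"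
    using norm_sqrt_iter_diff_le[OF assms] by (rule summable_comparison_test')
  then have "convergent (\<lambda>n. \<Sum>k<n. sqrt_iter a (Suc k) - sqrt_iter a k)"
    by (simp add: summable_iff_convergent)
  moreover have "(\<Sum>k<n. sqrt_iter a (Suc k) - sqrt_iter a k) = sqrt_iter a n" for n
    using sum_lessThan_telescope[of "sqrt_iter a" n] by (simp del: sqrt_iter.simps(2))
  ultimately show ?thesis by simp
qed

definition closed_subalgebra :: "'e::real_normed_algebra set \<Rightarrow> bool" where
  "closed_subalgebra K \<longleftrightarrow> closed K \<and> subspace K \<and> (\<forall>a\<in>K. \<forall>b\<in>K. a * b \<in> K)"

text \<open>
  The involution is a relation, since the adjointable operators are only a subset of the type of all
  bounded ones; \<open>J\<close> is the scalar \<open>\<i>\<close>.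
\<close>

locale star_relation =
  fixes adj :: "'e::{real_normed_algebra,monoid_mult,banach} \<Rightarrow> 'e \<Rightarrow> bool" and J :: 'e
  assumes adj_sym: "adj a a' \<Longrightarrow> adj a' a"
    and adj_add: "adj a a' \<Longrightarrow> adj b b' \<Longrightarrow> adj (a + b) (a' + b')"
    and adj_scaleR: "adj a a' \<Longrightarrow> adj (c *\<^sub>R a) (c *\<^sub>R a')"
    and adj_mult: "adj a a' \<Longrightarrow> adj b b' \<Longrightarrow> adj (a * b) (b' * a')"
    and adj_one: "adj 1 1"
    and adj_J: "adj J (- J)"
    and J_J: "J * J = - 1"
    and J_commute: "adj a a' \<Longrightarrow> a * J = J * a"
    and norm_J: "norm J \<le> 1"
    and norm_one_le: "norm (1::'e) \<le> 1"
    and closed_selfadj: "closed {a. adj a a}"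
    and cstar: "adj a a' \<Longrightarrow> (norm a)\<^sup>2 \<le> norm (a' * a)"
begin

lemma adj_uminus: "adj a a' \<Longrightarrow> adj (- a) (- a')"
  using adj_scaleR[of a a' "-1"] by simp

lemma adj_diff: "adj a a' \<Longrightarrow> adj b b' \<Longrightarrow> adj (a - b) (a' - b')"
  using adj_add[OF _ adj_uminus, of a a' b b'] by simp

lemma adj_zero: "adj 0 0"
  using adj_scaleR[OF adj_one, of 0] by simp

lemma adj_power: "adj a a \<Longrightarrow> adj (a ^ n) (a ^ n)"
proof (induction n)
  case (Suc n)
  then show ?case using adj_mult[of a a "a ^ n" "a ^ n"] by (simp add: power_commutes)
qed (simp add: adj_one)

lemma adj_eq_0: "adj a a' \<Longrightarrow> a' * a = 0 \<Longrightarrow> a = 0"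
  using cstar[of a a'] by simp

lemma selfadj_tendsto: "(\<And>n. adj (f n) (f n)) \<Longrightarrow> f \<longlonglongrightarrow> a \<Longrightarrow> adj a a"
  using closed_sequentially[OF closed_selfadj, of f a] by simp

text \<open>For self-adjoint elements the norm condition says that the spectrum lies in \<open>[0, 2t]\<close>.\<close>

definition pos :: "'e \<Rightarrow> bool" where
  "pos a \<longleftrightarrow> adj a a \<and> (\<exists>t. norm (t *\<^sub>R 1 - a) \<le> t)"

lemma pos_selfadj: "pos a \<Longrightarrow> adj a a"
  by (simp add: pos_def)

lemma pos_add:
  assumes "pos a" "pos b" shows "pos (a + b)"
proof -
  obtain s t where "norm (s *\<^sub>R 1 - a) \<le> s" "norm (t *\<^sub>R 1 - b) \<le> t"
    using assms by (auto simp: pos_def)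
  then have "norm ((s + t) *\<^sub>R 1 - (a + b)) \<le> s + t"
    using norm_triangle_mono[of "s *\<^sub>R 1 - a" s "t *\<^sub>R 1 - b" t] by (simp add: algebra_simps)
  then show ?thesis using assms by (auto simp: pos_def intro: adj_add)
qed

lemma pos_scaleR:
  assumes "pos a" "c \<ge> 0" shows "pos (c *\<^sub>R a)"
proof -
  obtain t where "norm (t *\<^sub>R 1 - a) \<le> t" using assms by (auto simp: pos_def)
  then have "norm ((c * t) *\<^sub>R 1 - c *\<^sub>R a) \<le> c * t"
    using assms(2) mult_left_mono[of "norm (t *\<^sub>R 1 - a)" t c]
    by (simp flip: scaleR_scaleR scaleR_diff_right)
  then show ?thesis using assms by (auto simp: pos_def intro: adj_scaleR)
qed

lemma pos_zero: "pos 0"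
  by (auto simp: pos_def adj_zero intro: exI[of _ 0])

lemma pos_one: "pos 1"
  by (auto simp: pos_def adj_one intro: exI[of _ 1])

lemma pos_one_minus:
  assumes "adj a a" "norm a \<le> 1" shows "pos (1 - a)"
  using assms by (auto simp: pos_def intro!: adj_diff adj_one exI[of _ 1])

text \<open>The root is \<open>1 - y\<close>, where \<open>y\<close> is the limit of the iteration
  for \<open>1 - a\<close>; self-adjointness, the norm bound and commutation pass to the
  limit.\<close>

lemma sqrt_near_one:
  assumes adj: "adj a a" and le: "norm (1 - a) \<le> 1"
  obtains r where "pos r" "r * r = a" "\<forall>b. b * a = a * b \<longrightarrow> b * r = r * b"
    "\<forall>K. closed_subalgebra K \<longrightarrow> a \<in> K \<longrightarrow> r \<in> K"
proof -
  define f where "f = sqrt_iter (1 - a)"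
  obtain y where y: "f \<longlonglongrightarrow> y"
    using sqrt_iter_convergent[OF le] by (auto simp: convergent_def f_def)
  have "(\<lambda>n. f (Suc n)) \<longlonglongrightarrow> (1/2) *\<^sub>R ((1 - a) + y * y)"
    unfolding f_def sqrt_iter.simps by (intro tendsto_intros y[unfolded f_def])
  then have "y = (1/2) *\<^sub>R ((1 - a) + y * y)"
    using LIMSEQ_unique[OF LIMSEQ_Suc[OF y]] by blast
  then have "2 *\<^sub>R y = 2 *\<^sub>R ((1/2) *\<^sub>R ((1 - a) + y * y))" by (rule arg_cong)
  then have fix_eq: "y + y = 1 - a + y * y" by (simp add: scaleR_2)
  show thesis
  proof
    have "adj (f n) (f n)" for n
      unfolding f_def by (induction n) (auto intro!: adj adj_one adj_zero adj_scaleR adj_add adj_diff adj_mult)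
    then have "adj y y" using y by (rule selfadj_tendsto)
    moreover have "norm y \<le> 1"
      using tendsto_norm[OF y] norm_sqrt_iter_le[OF le] sqrt_iter_real_bounds unfolding f_def
      by (intro LIMSEQ_le_const2[where a = 1]) (auto intro: order_trans)
    ultimately show "pos (1 - y)" by (rule pos_one_minus)
    show "(1 - y) * (1 - y) = a"
      using fix_eq by (simp add: left_diff_distrib right_diff_distrib algebra_simps)
    show "\<forall>b. b * a = a * b \<longrightarrow> b * (1 - y) = (1 - y) * b"
    proof (intro allI impI)
      fix b assume that: "b * a = a * b"
      have "b * f n = f n * b" for n
        unfolding f_def by (rule sqrt_iter_commute) (simp add: that left_diff_distrib right_diff_distrib)
      moreover have "(\<lambda>n. b * f n) \<longlonglongrightarrow> b * y" "(\<lambda>n. f n * b) \<longlonglongrightarrow> y * b"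
        by (intro tendsto_intros y)+
      ultimately have "b * y = y * b" using LIMSEQ_unique by simp
      then show "b * (1 - y) = (1 - y) * b" by (simp add: left_diff_distrib right_diff_distrib)
    qed
    show "\<forall>K. closed_subalgebra K \<longrightarrow> a \<in> K \<longrightarrow> 1 - y \<in> K"
    proof (intro allI impI)
      fix K assume K: "closed_subalgebra K" "a \<in> K"
      have sub: "subspace K" and mult: "\<And>a b. a \<in> K \<Longrightarrow> b \<in> K \<Longrightarrow> a * b \<in> K"
        using K by (auto simp: closed_subalgebra_def)
      \<comment> \<open>The iterates \<open>f n\<close> may leave \<open>K\<close>, since
        \<open>1\<close> may. They differ from scalar multiples of \<open>1\<close> by elements of
        \<open>K\<close>, and these scalars tend to 1.\<close>
      have "sqrt_iter 1 n *\<^sub>R 1 - f n \<in> K" for n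
      proof (induction n)
        case 0
        show ?case by (simp add: f_def subspace_0[OF sub])
      next
        case (Suc n)
        define s where "s = sqrt_iter (1::real) n"
        define k where "k = s *\<^sub>R 1 - f n"
        have fn: "f n = s *\<^sub>R 1 - k" by (simp add: k_def)
        have "2 *\<^sub>R (sqrt_iter 1 (Suc n) *\<^sub>R 1 - f (Suc n)) = a + (s *\<^sub>R k + s *\<^sub>R k) - k * k"
          unfolding sqrt_iter.simps f_def s_def[symmetric]
          unfolding f_def[symmetric] fn
          by (simp add: left_diff_distrib right_diff_distrib algebra_simps add_divide_distrib)
        then have "sqrt_iter 1 (Suc n) *\<^sub>R 1 - f (Suc n)
            = (1/2) *\<^sub>R (a + (s *\<^sub>R k + s *\<^sub>R k) - k * k)"
          by (metis (no_types) scaleR_half_double scaleR_2 scaleR_right_distrib)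
        also have "\<dots> \<in> K"
          using Suc K by (intro subspace_scale[OF sub] subspace_diff[OF sub] subspace_add[OF sub] mult)
            (auto simp: k_def s_def)
        finally show ?case .
      qed
      moreover have "(\<lambda>n. sqrt_iter 1 n *\<^sub>R 1 - f n) \<longlonglongrightarrow> 1 *\<^sub>R 1 - y"
        by (intro tendsto_intros y sqrt_iter_real_tendsto)
      moreover have "closed K" using K by (simp add: closed_subalgebra_def)
      ultimately show "1 - y \<in> K" using closed_sequentially[of K] by fastforce
    qed
  qed
qed

lemma pos_sqrt:
  assumes "pos a"
  obtains r where "pos r" "r * r = a" "\<forall>b. b * a = a * b \<longrightarrow> b * r = r * b"
    "\<forall>K. closed_subalgebra K \<longrightarrow> a \<in> K \<longrightarrow> r \<in> K"
proof -
  obtain t where t: "norm (t *\<^sub>R 1 - a) \<le> t" using assms by (auto simp: pos_def)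
  \<comment> \<open>Enlarging \<open>t\<close> by 1 keeps the norm condition and makes division by
    \<open>s\<close> legitimate even when \<open>t = 0\<close>.\<close>
  define s where "s = t + 1"
  have s: "s > 0" using order_trans[OF norm_ge_zero t] by (simp add: s_def)
  have "norm (s *\<^sub>R 1 - a) \<le> norm (t *\<^sub>R 1 - a) + norm (1::'e)"
    using norm_triangle_ineq[of "t *\<^sub>R 1 - a" 1] by (simp add: s_def algebra_simps)
  then have "norm (s *\<^sub>R 1 - a) \<le> s" using t norm_one_le by (simp add: s_def)
  moreover have "s *\<^sub>R 1 - a = s *\<^sub>R (1 - inverse s *\<^sub>R a)"
    using s by (simp add: algebra_simps)
  ultimately have "norm (1 - inverse s *\<^sub>R a) \<le> 1"
    using s by simp
  then obtain r where r: "pos r" "r * r = inverse s *\<^sub>R a"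
      "\<forall>b. b * (inverse s *\<^sub>R a) = inverse s *\<^sub>R a * b \<longrightarrow> b * r = r * b"
      "\<forall>K. closed_subalgebra K \<longrightarrow> inverse s *\<^sub>R a \<in> K \<longrightarrow> r \<in> K"
    using sqrt_near_one[OF adj_scaleR[OF pos_selfadj[OF assms]]] by blast
  show thesis
  proof
    show "pos (sqrt s *\<^sub>R r)" using s by (intro pos_scaleR r) auto
    show "(sqrt s *\<^sub>R r) * (sqrt s *\<^sub>R r) = a" using s r(2) by (simp flip: mult.assoc)
    show "\<forall>b. b * a = a * b \<longrightarrow> b * (sqrt s *\<^sub>R r) = (sqrt s *\<^sub>R r) * b"
      using r(3) by simp
    show "\<forall>K. closed_subalgebra K \<longrightarrow> a \<in> K \<longrightarrow> sqrt s *\<^sub>R r \<in> K"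
      using r(4) by (auto simp: closed_subalgebra_def subspace_scale)
  qed
qed

end

lemma commute_mult:
  fixes a :: "'a::semigroup_mult"
  assumes "a * b = b * a" "a * c = c * a"
  shows "a * (b * c) = b * c * a"
proof -
  have "a * (b * c) = b * (a * c)" by (simp add: assms(1) flip: mult.assoc)
  then show ?thesis by (simp add: assms(2) mult.assoc)
qed

lemma commute_square:
  fixes u :: "'a::semigroup_mult"
  assumes "u * v = v * u"
  shows "u * v * (u * v) = u * u * (v * v)"
proof -
  have "u * v * (u * v) = u * (v * u) * v" by (simp add: mult.assoc)
  then show ?thesis by (simp add: assms[symmetric] mult.assoc)
qed

section \<open>Norm and order of positive elements\<close>

context star_relation
begin

text \<open>The element \<open>r + J * s\<close> behaves like the unitary r + is: its products with
  its adjoint \<open>r - J * s\<close> are 1, so both have norm at most 1, and \<open>J * s\<close>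
  is half their difference.\<close>

lemma norm_le_one_if_squares_sum_to_one:
  assumes r: "adj r r" and s: "adj s s" and comm: "r * s = s * r" and sum: "r * r + s * s = 1"
  shows "norm s \<le> 1"
proof -
  have sJ: "s * J = J * s" and rJ: "r * J = J * r" using J_commute r s by auto
  have adj: "adj (r + J * s) (r - J * s)"
    using adj_add[OF r adj_mult[OF adj_J s]] sJ by simp
  have JsJs: "J * s * (J * s) = - (s * s)"
    using commute_square[OF sJ[symmetric]] by (simp add: J_J)
  have rJs: "r * (J * s) = J * s * r"
    by (rule commute_mult[OF rJ comm])
  have "(r - J * s) * (r + J * s) = r * r + s * s" "(r + J * s) * (r - J * s) = r * r + s * s"
    by (simp_all add: distrib_left distrib_right left_diff_distrib right_diff_distrib JsJs rJs)
  then have "(norm (r + J * s))\<^sup>2 \<le> 1" "(norm (r - J * s))\<^sup>2 \<le> 1"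
    using cstar[OF adj] cstar[OF adj_sym[OF adj]] norm_one_le sum by auto
  then have "norm (r + J * s) \<le> 1" "norm (r - J * s) \<le> 1"
    by (auto simp: power_le_one_iff abs_square_le_1)
  then have "norm ((r + J * s) - (r - J * s)) \<le> 2"
    by (intro order_trans[OF norm_triangle_ineq4]) auto
  moreover have "(r + J * s) - (r - J * s) = 2 *\<^sub>R (J * s)" by (simp add: scaleR_2)
  ultimately have "norm (J * s) \<le> 1" by simp
  moreover have "s = - (J * (J * s))" by (simp add: J_J flip: mult.assoc)
  then have "norm s \<le> norm J * norm (J * s)" by (metis norm_minus_cancel norm_mult_ineq)
  ultimately show ?thesis using norm_J mult_le_one[of "norm J" "norm (J * s)"] by simp
qed

text \<open>After scaling to norm at most 1, take roots \<open>u\<close> of \<open>1 - s\<close> and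
  \<open>v\<close> of \<open>1 + s\<close>. Then \<open>u * v\<close> is a self-adjoint root of
  \<open>1 - s * s\<close>, so the preceding lemma bounds it by 1. This gives the norm condition for
  \<open>s * s\<close> with \<open>t = 1\<close>.\<close>

lemma pos_square:
  assumes "adj r r" shows "pos (r * r)"
proof -
  define c where "c = norm r + 1"
  define s where "s = inverse c *\<^sub>R r"
  have c: "c > 0" by (simp add: c_def add_nonneg_pos)
  have s: "adj s s" unfolding s_def by (rule adj_scaleR[OF assms])
  have "norm s \<le> 1" using c by (simp add: s_def field_simps c_def)
  moreover have eq: "1 - (1 - s) = s" "1 - (1 + s) = - s" by simp_all
  moreover have "adj (1 - s) (1 - s)" "adj (1 + s) (1 + s)"
    by (intro adj_diff adj_add adj_one s)+
  ultimately obtain u v where u: "pos u" "u * u = 1 - s" "\<forall>b. b * (1 - s) = (1 - s) * b \<longrightarrow> b * u = u * b"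
    and v: "pos v" "v * v = 1 + s" "\<forall>b. b * (1 + s) = (1 + s) * b \<longrightarrow> b * v = v * b"
    using sqrt_near_one[of "1 - s"] sqrt_near_one[of "1 + s"] by (metis norm_minus_cancel)
  have us: "s * u = u * s" by (rule u(3)[rule_format]) (simp add: algebra_simps)
  then have uv: "u * v = v * u" by (intro v(3)[rule_format]) (simp add: algebra_simps)
  have sv: "s * v = v * s" by (rule v(3)[rule_format]) (simp add: algebra_simps)
  have "adj (u * v) (u * v)"
    using adj_mult[OF pos_selfadj[OF u(1)] pos_selfadj[OF v(1)]] uv by simp
  moreover have sq: "u * v * (u * v) = 1 - s * s"
  proof -
    have "u * v * (u * v) = (u * u) * (v * v)" by (rule commute_square[OF uv])
    then show ?thesis by (simp add: u(2) v(2) algebra_simps)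
  qed
  moreover have "s * (u * v) = u * v * s" by (rule commute_mult[OF us sv])
  ultimately have "norm (u * v) \<le> 1"
    using norm_le_one_if_squares_sum_to_one[of s "u * v"] s by simp
  then have "norm (1 - s * s) \<le> 1"
    using norm_mult_ineq[of "u * v" "u * v"] mult_le_one[of "norm (u * v)" "norm (u * v)"]
    by (simp add: sq)
  then have "pos (s * s)" using adj_mult[OF s s] by (auto simp: pos_def intro!: exI[of _ 1])
  then have "pos ((c * c) *\<^sub>R (s * s))" by (rule pos_scaleR) (use c in auto)
  moreover have "c * c * (inverse c * inverse c) = 1" using c by (simp add: field_simps)
  then have "(c * c) *\<^sub>R (s * s) = r * r" by (simp add: s_def)
  ultimately show ?thesis by simp
qed

lemma pos_mult:
  assumes "pos a" "pos b" "a * b = b * a"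
  shows "pos (a * b)"
proof -
  obtain s where s: "pos s" "s * s = a" "\<forall>c. c * a = a * c \<longrightarrow> c * s = s * c"
    by (rule pos_sqrt[OF assms(1)]) (rule that)
  obtain t where t: "pos t" "t * t = b" "\<forall>c. c * b = b * c \<longrightarrow> c * t = t * c"
    by (rule pos_sqrt[OF assms(2)]) (rule that)
  have "s * b = b * s" using s(3)[rule_format, of b] assms(3) by simp
  then have st: "s * t = t * s" by (rule t(3)[rule_format])
  have "s * t * (s * t) = (s * s) * (t * t)" by (rule commute_square[OF st])
  moreover have "adj (s * t) (s * t)"
    using adj_mult[OF pos_selfadj[OF s(1)] pos_selfadj[OF t(1)]] st by simp
  ultimately show ?thesis using pos_square[of "s * t"] s(2) t(2) by simp
qed

lemma pos_power: "pos a \<Longrightarrow> pos (a ^ n)"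
proof (induction n)
  case (Suc n)
  then show ?case using pos_mult[of a "a ^ n"] by (simp add: power_commutes)
qed (simp add: pos_one)

text \<open>Commuting roots of \<open>p\<close> and \<open>1 - p\<close> have squares summing to
  1.\<close>

lemma norm_le_one_if_pos:
  assumes "pos p" "pos (1 - p)" shows "norm p \<le> 1"
proof -
  obtain s where s: "pos s" "s * s = p" "\<forall>c. c * p = p * c \<longrightarrow> c * s = s * c"
    by (rule pos_sqrt[OF assms(1)]) (rule that)
  obtain r where r: "pos r" "r * r = 1 - p" "\<forall>c. c * (1 - p) = (1 - p) * c \<longrightarrow> c * r = r * c"
    by (rule pos_sqrt[OF assms(2)]) (rule that)
  have "p * s = s * p" by (rule s(3)[rule_format]) simp
  then have "s * r = r * s" by (intro r(3)[rule_format]) (simp add: algebra_simps)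
  then have "norm s \<le> 1"
    using norm_le_one_if_squares_sum_to_one[of r s] s(1,2) r(1,2) by (simp add: pos_selfadj)
  then show ?thesis
    using norm_mult_ineq[of s s] mult_le_one[of "norm s" "norm s"] s(2) by simp
qed

text \<open>Dividing by \<open>norm b + e\<close> reduces to \<open>b\<close> below 1; then
  \<open>a\<close> is below 1 as well. The \<open>e\<close> guards against
  \<open>b = 0\<close>.\<close>

lemma norm_mono:
  assumes "pos a" "pos (b - a)" shows "norm a \<le> norm b"
proof (rule field_le_epsilon)
  fix e :: real assume e: "e > 0"
  define t where "t = norm b + e"
  have t: "t > 0" using e by (simp add: t_def add_nonneg_pos)
  have "pos b" using pos_add[OF assms] by simp
  moreover have "norm (inverse t *\<^sub>R b) \<le> 1" using e t by (simp add: t_def field_simps)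
  ultimately have "pos (1 - inverse t *\<^sub>R b)"
    by (intro pos_one_minus adj_scaleR pos_selfadj)
  moreover have "pos (inverse t *\<^sub>R (b - a))" using t by (intro pos_scaleR assms) auto
  ultimately have "pos (1 - inverse t *\<^sub>R b + inverse t *\<^sub>R (b - a))" by (rule pos_add)
  then have "pos (1 - inverse t *\<^sub>R a)" by (simp add: algebra_simps)
  moreover have "pos (inverse t *\<^sub>R a)" using t by (intro pos_scaleR assms) auto
  ultimately have "norm (inverse t *\<^sub>R a) \<le> 1" by (intro norm_le_one_if_pos)
  then show "norm a \<le> norm b + e" using t by (simp add: t_def field_simps)
qed

lemma pos_antisym:
  assumes "pos a" "pos (- a)" shows "a = 0"
proof -
  have "norm a \<le> norm (0::'e)" by (rule norm_mono) (use assms in simp_all)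
  then show ?thesis by simp
qed

lemma norm_one_minus_le:
  assumes "pos a" "norm a \<le> 1" shows "norm (1 - a) \<le> 1"
proof -
  have "norm (1 - a) \<le> norm (1::'e)"
    using norm_mono[OF pos_one_minus[OF pos_selfadj[OF assms(1)] assms(2)], of 1] assms(1) by simp
  then show ?thesis using norm_one_le by simp
qed

text \<open>Bernoulli-type inequalities. The second one forces growth linear in \<open>n\<close>
  unless the square of \<open>a\<close> vanishes.\<close>

lemma pos_one_plus_power:
  assumes "pos a"
  shows "pos ((1 + a) ^ n - 1)" "pos ((1 + a) ^ n * a - real n *\<^sub>R (a * a))"
proof -
  have comm: "(1 + a) ^ n * a = a * (1 + a) ^ n" for n
    by (rule power_commuting_commutes) (simp add: algebra_simps)
  have *: "pos ((1 + a) ^ n - 1)" for n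
  proof (induction n)
    case (Suc n)
    have "pos ((1 + a) ^ n * a)"
      by (intro pos_mult pos_power pos_add pos_one assms comm)
    with Suc have "pos (((1 + a) ^ n - 1) + (1 + a) ^ n * a)" by (rule pos_add)
    then show ?case by (simp add: power_commutes[symmetric] algebra_simps comm)
  qed (simp add: pos_zero)
  then show "pos ((1 + a) ^ n - 1)" .
  show "pos ((1 + a) ^ n * a - real n *\<^sub>R (a * a))"
  proof (induction n)
    case (Suc n)
    have c: "((1 + a) ^ n - 1) * (a * a) = a * a * ((1 + a) ^ n - 1)"
      using comm[of n] by (intro commute_mult) (simp_all add: algebra_simps)
    have "pos (((1 + a) ^ n - 1) * (a * a))"
      by (rule pos_mult[OF * pos_mult[OF assms assms refl] c])
    with Suc have "pos (((1 + a) ^ n * a - real n *\<^sub>R (a * a)) + ((1 + a) ^ n - 1) * (a * a))"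
      by (rule pos_add)
    also have "((1 + a) ^ n * a - real n *\<^sub>R (a * a)) + ((1 + a) ^ n - 1) * (a * a)
      = (1 + a) ^ n * (1 + a) * a - real (Suc n) *\<^sub>R (a * a)"
      by (simp add: algebra_simps)
    finally show ?case by (simp only: power_Suc2)
  qed (simp add: assms)
qed

section \<open>Positivity of \<open>b' * b\<close>\<close>

text \<open>
  If \<open>T = d d' \<ge> 0\<close> and \<open>S = - d' d \<ge> 0\<close>, then \<open>(1 - T) d = d (1 + S)\<close>. For \<open>T \<le> 1\<close> the powers of
  the left side stay bounded, whereas those of \<open>1 + S\<close> grow unless \<open>S = 0\<close>.
\<close>

lemma eq_zero_if_pos_neg_contraction:
  assumes d: "adj d d'" and T: "pos (d * d')" "norm (d * d') \<le> 1" and S: "pos (- (d' * d))"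
  shows "d = 0"
proof -
  define S where "S = - (d' * d)"
  define u where "u = 1 - d * d'"
  have u: "norm u \<le> 1" unfolding u_def by (rule norm_one_minus_le[OF T])
  have un: "norm (u ^ n * d) \<le> norm d" for n
  proof (induction n)
    case (Suc n)
    have "norm (u ^ Suc n * d) \<le> norm u * norm (u ^ n * d)"
      using norm_mult_ineq[of u "u ^ n * d"] by (simp add: mult.assoc)
    also have "\<dots> \<le> 1 * norm d" by (intro mult_mono u Suc) auto
    finally show ?case by simp
  qed simp
  have ud: "u * d = d * (1 + S)" by (simp add: u_def S_def algebra_simps)
  have und: "u ^ n * d = d * (1 + S) ^ n" for n
  proof (induction n)
    case (Suc n)
    have "u ^ Suc n * d = u ^ n * (u * d)" by (simp add: power_Suc2 mult.assoc del: power_Suc)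
    also have "\<dots> = d * (1 + S) ^ n * (1 + S)" by (simp add: ud Suc flip: mult.assoc)
    finally show ?case by (simp add: power_commutes mult.assoc)
  qed simp
  have S': "pos S" using S by (simp add: S_def)
  have comm: "(1 + S) ^ n * S = S * (1 + S) ^ n" for n
    by (rule power_commuting_commutes) (simp add: algebra_simps)
  \<comment> \<open>Here n S^2 is dominated by (1 + S)^n S, which equals -d' u^n d and is therefore
    bounded independently of \<open>n\<close>.\<close>
  have "real n * norm (S * S) \<le> norm d' * norm d" for n
  proof -
    have "real n * norm (S * S) = norm (real n *\<^sub>R (S * S))" by simp
    also have "\<dots> \<le> norm ((1 + S) ^ n * S)"
      by (intro norm_mono pos_one_plus_power S' pos_scaleR pos_mult) auto
    also have "(1 + S) ^ n * S = - (d' * (u ^ n * d))"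
      by (simp add: comm und) (simp add: S_def mult.assoc)
    also have "norm \<dots> \<le> norm d' * norm d"
      by (simp, intro order_trans[OF norm_mult_ineq] mult_left_mono un) auto
    finally show ?thesis .
  qed
  then have "norm (S * S) \<le> 0"
    by (metis ex_less_of_nat_mult linorder_not_less)
  then have "S = 0" using adj_eq_0[of S S] S' by (simp add: pos_selfadj)
  then show ?thesis using adj_eq_0[OF d] by (simp add: S_def)
qed

text \<open>\<open>X\<close> and \<open>Y\<close> are, up to sign, twice the real and imaginary
  parts of \<open>d\<close>, and X^2 + Y^2 = 2 (d' d + d d'). So \<open>d * d'\<close> is a sum of
  positive elements, and after scaling the contraction lemma applies. It takes the place of
  comparing the spectra of \<open>d' * d\<close> and \<open>d * d'\<close>.\<close>

lemma eq_zero_if_neg: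
  assumes d: "adj d d'" and S: "pos (- (d' * d))"
  shows "d = 0"
proof -
  define X where "X = d + d'"
  define Y where "Y = J * (d - d')"
  have dJ: "d * J = J * d" "d' * J = J * d'" by (fact J_commute[OF d], fact J_commute[OF adj_sym[OF d]])
  have "adj X X" unfolding X_def using adj_add[OF d adj_sym[OF d]] by (simp add: add.commute)
  moreover have "adj Y Y"
    using adj_mult[OF adj_J adj_diff[OF d adj_sym[OF d]]] dJ by (simp add: Y_def algebra_simps)
  moreover have "Y * Y = - ((d - d') * (d - d'))"
  proof -
    have comm: "J * (d - d') = (d - d') * J" by (simp add: algebra_simps dJ)
    show ?thesis unfolding Y_def commute_square[OF comm] by (simp add: J_J)
  qed
  then have "X * X + Y * Y + (- (d' * d) + - (d' * d)) = 2 *\<^sub>R (d * d')"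
    by (simp add: X_def algebra_simps scaleR_2)
  ultimately have "pos ((1/2) *\<^sub>R (2 *\<^sub>R (d * d')))"
    by (metis pos_scaleR pos_add pos_square S zero_le_divide_1_iff zero_le_numeral)
  then have T: "pos (d * d')" by simp
  define c where "c = inverse (norm (d * d') + 1)"
  have c: "c > 0" unfolding c_def by (simp add: add_nonneg_pos)
  have "c * norm (d * d') \<le> 1" by (simp add: c_def field_simps divide_le_eq_1 add_pos_nonneg)
  then have "sqrt c *\<^sub>R d = 0"
    using c pos_scaleR[OF S, of c] pos_scaleR[OF T, of c]
    by (intro eq_zero_if_pos_neg_contraction[of _ "sqrt c *\<^sub>R d'"]) (auto intro: adj_scaleR d)
  then show ?thesis using c by simp
qed

text \<open>Candidate for the negative part of \<open>a\<close>, up to a factor 2.\<close>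

lemma abs_minus_obtain:
  assumes a: "adj a a"
  obtains m n s where "pos m" "n = m - a" "n * a = - (n * m)" "n * m = m * n"
    "pos s" "s * s = m" "s * n = n * s"
proof -
  obtain m where m: "pos m" "m * m = a * a" "\<forall>c. c * (a * a) = a * a * c \<longrightarrow> c * m = m * c"
    by (rule pos_sqrt[OF pos_square[OF a]]) (rule that)
  obtain s where s: "pos s" "s * s = m" "\<forall>c. c * m = m * c \<longrightarrow> c * s = s * c"
    by (rule pos_sqrt[OF m(1)]) (rule that)
  have am: "a * m = m * a" by (rule m(3)[rule_format]) (simp add: mult.assoc)
  show thesis
  proof (rule that)
    show "(m - a) * a = - ((m - a) * m)" using am m(2) by (simp add: algebra_simps)
    show nm: "(m - a) * m = m * (m - a)" using am by (simp add: algebra_simps)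
    show "s * (m - a) = (m - a) * s" using s(3)[rule_format, OF nm] by simp
  qed (use m(1) s(1,2) in simp_all)
qed

text \<open>With c = b' b and n = |c| - c, the element (b n)' (b n) = n c n = -n |c| n is negative,
  so b n = 0 by \<open>eq_zero_if_neg\<close>. This makes n^2 vanish, hence c = |c|.\<close>

lemma pos_adj_mult:
  assumes b: "adj b b'" shows "pos (b' * b)"
proof -
  define c where "c = b' * b"
  have c: "adj c c" unfolding c_def using adj_mult[OF adj_sym[OF b] b] .
  obtain m n s where mn: "pos m" "n = m - c" "n * c = - (n * m)" "n * m = m * n"
      "pos s" "s * s = m" "s * n = n * s"
    by (rule abs_minus_obtain[OF c])
  have n: "adj n n" unfolding mn(2) by (intro adj_diff c pos_selfadj mn)
  have nmn: "n * m * n = n * s * (n * s)"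
    using commute_square[OF mn(7)[symmetric]]
    by (simp add: mn(6) mn(4)[symmetric] mult.assoc)
  have "adj (n * s) (n * s)" using adj_mult[OF n pos_selfadj[OF mn(5)]] mn(7) by simp
  then have "pos (n * m * n)" using pos_square nmn by simp
  moreover have "n * b' * (b * n) = - (n * m * n)"
  proof -
    have "n * b' * (b * n) = (n * c) * n" by (simp add: c_def mult.assoc)
    then show ?thesis by (simp add: mn(3))
  qed
  moreover have "adj (b * n) (n * b')" by (rule adj_mult[OF b n])
  ultimately have "b * n = 0" by (intro eq_zero_if_neg[of _ "n * b'"]) auto
  then have cn: "c * n = 0" by (simp add: c_def mult.assoc)
  have m_eq: "m = c + n" using mn(2) by simp
  have nc: "n * c = 0" using mn(4) cn by (simp add: m_eq distrib_left distrib_right)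
  then have "n * m = 0" using mn(3) by simp
  then have "n * n = 0" using nc by (simp add: m_eq distrib_left)
  then have "n = 0" using adj_eq_0[OF n] by simp
  then show ?thesis using mn(1) by (simp add: m_eq c_def)
qed

text \<open>With q = 1 - h, the sum of q^j h over j < n telescopes to 1 - q^n. Its terms decrease,
  so n q^n h is at most 1 - q^n; the induction proves this directly.\<close>

lemma norm_power_mult_le:
  assumes "pos h" "pos (1 - h)"
  shows "real n * norm ((1 - h) ^ n * h) \<le> 1"
proof -
  define q where "q = 1 - h"
  have q: "pos q" using assms by (simp add: q_def)
  have comm: "q ^ n * h = h * q ^ n" for n
    by (rule power_commuting_commutes) (simp add: algebra_simps q_def)
  have step: "q ^ Suc n = q ^ n - q ^ n * h" for n
    by (simp only: power_Suc2) (simp add: q_def algebra_simps)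
  have qh: "pos (q ^ n * h)" for n
    using q assms comm by (intro pos_mult pos_power) auto
  have qhh: "pos (q ^ n * h * h)" for n
    by (rule pos_mult[OF qh assms(1)]) (simp add: comm mult.assoc)
  have one: "pos (1 - q ^ n)" for n
  proof (induction n)
    case (Suc n)
    then show ?case using pos_add[OF Suc qh[of n]] by (simp only: step) (simp add: algebra_simps)
  qed (simp add: pos_zero)
  have "pos (1 - q ^ n - real n *\<^sub>R (q ^ n * h))"
  proof (induction n)
    case (Suc n)
    have eq: "1 - q ^ Suc n - real (Suc n) *\<^sub>R (q ^ Suc n * h)
      = (1 - q ^ n - real n *\<^sub>R (q ^ n * h)) + real (Suc n) *\<^sub>R (q ^ n * h * h)"
      by (simp only: step) (simp add: algebra_simps)
    show ?case unfolding eq by (intro pos_add Suc pos_scaleR qhh) simp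
  qed (simp add: pos_zero)
  then have "norm (real n *\<^sub>R (q ^ n * h)) \<le> norm (1 - q ^ n)"
    by (intro norm_mono pos_scaleR qh) auto
  also have "\<dots> \<le> norm (1::'e)"
    using pos_power[OF q] by (intro norm_mono one) simp
  finally show ?thesis using norm_one_le by (simp add: q_def)
qed

end

section \<open>Operators on Hilbert modules\<close>

definition imag_endo :: "'x::complex_normed_vector endo" where
  "imag_endo = Endo (\<i> *\<^sub>C id_blinfun)"

lemma imag_endo_apply [simp]: "op_of imag_endo x = \<i> *\<^sub>C x"
  by (simp add: imag_endo_def scaleC_blinfun.rep_eq)

context hilbert_module
begin

lemma ip_scaleR_left: "ip (r *\<^sub>R x) y = r *\<^sub>R ip x y"
  by (simp add: scaleR_scaleC ip_scaleC_left)

lemma ip_scaleR_right: "ip x (r *\<^sub>R y) = r *\<^sub>R ip x y"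
  by (simp add: scaleR_scaleC ip_scaleC_right)

sublocale ip: bounded_bilinear ip
proof
  have "norm (ip x y) \<le> norm x * norm y * 4" for x y using norm_ip_le[of x y] by (simp add: mult_ac)
  then show "\<exists>K. \<forall>x y. norm (ip x y) \<le> norm x * norm y * K" by blast
qed (simp_all add: ip_add_left ip_add_right ip_scaleR_left ip_scaleR_right)

sublocale act: bounded_bilinear act
proof
  show "\<exists>K. \<forall>x a. norm (act x a) \<le> norm x * norm a * K"
    using norm_act_le by (intro exI[of _ 1]) simp
qed (simp_all add: act_add_left act_add_right scaleR_scaleC act_scaleC_left act_scaleC_right)

lemma ip_act_left: "ip (act x a) y = star a * ip x y"
  by (metis ip_act_right star_ip star_mult)

lemma ip_ext: "(\<And>z. ip z x = ip z y) \<Longrightarrow> x = y"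
  using ip_definite[of "x - y"] by (simp add: ip.diff_right)

definition adj :: "'x endo \<Rightarrow> 'x endo \<Rightarrow> bool" where
  "adj S T \<longleftrightarrow> is_adjoint ip (op_of S) (op_of T)"

lemma adj_iff: "adj S T \<longleftrightarrow> (\<forall>x y. ip (op_of S x) y = ip x (op_of T y))"
  by (simp add: adj_def is_adjoint_def)

end

text \<open>Cauchy-Schwarz is an assumption here in order to avoid a circle: the operator theory is
  first instantiated on the algebra itself, and the positivity obtained there proves the inequality
  for every Hilbert module.\<close>

locale cs_hilbert_module = hilbert_module +
  assumes norm_ip_le_mult: "norm (ip x y) \<le> norm x * norm y"
begin

sublocale op: star_relation adj imag_endo
proof
  show sym: "adj T S" if "adj S T" for S T
    using that unfolding adj_iff by (metis star_ip)
  show "adj (S + S') (T + T')" if "adj S T" "adj S' T'" for S T S' T'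
    using that by (simp add: adj_iff plus_blinfun.rep_eq ip_add_left ip_add_right)
  show "adj (c *\<^sub>R S) (c *\<^sub>R T)" if "adj S T" for c S T
    using that by (simp add: adj_iff scaleR_blinfun.rep_eq ip_scaleR_left ip_scaleR_right)
  show "adj (S * S') (T' * T)" if "adj S T" "adj S' T'" for S T S' T'
    using that by (simp add: adj_iff)
  show "adj 1 1" by (simp add: adj_iff)
  show "adj imag_endo (- imag_endo)"
    by (simp add: adj_iff uminus_blinfun.rep_eq ip_scaleC_left ip_scaleC_right ip.minus_right)
  show "imag_endo * imag_endo = (- 1 :: 'a endo)"
    by (rule endo_eqI) (simp add: uminus_blinfun.rep_eq scaleC_scaleC)
  \<comment> \<open>The operators are only real-linear by type; having an adjoint forces complex
    linearity.\<close>
  show "S * imag_endo = imag_endo * S" if "adj S T" for S T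
  proof -
    have "ip z (op_of S y) = ip (op_of T z) y" for y z
      using sym[OF that] by (simp add: adj_iff)
    then show ?thesis by (intro endo_eqI ip_ext) (simp add: ip_scaleC_right)
  qed
  show "norm (imag_endo :: 'a endo) \<le> 1"
    by (subst norm_op_of[symmetric], rule norm_blinfun_bound) (simp_all add: norm_scaleC)
  show "norm (1 :: 'a endo) \<le> 1"
    by (simp add: norm_blinfun_id_le flip: norm_op_of)
  show "closed {S. adj S S}"
    unfolding closed_sequential_limits
  proof safe
    fix f S assume f: "\<forall>n. f n \<in> {S. adj S S}" "f \<longlonglongrightarrow> S"
    have lim: "(\<lambda>n. op_of (f n) x) \<longlonglongrightarrow> op_of S x" for x
      using bounded_linear.tendsto[OF bounded_linear_op_of f(2)] by (intro tendsto_intros)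
    have "ip (op_of S x) y = ip x (op_of S y)" for x y
    proof (rule LIMSEQ_unique)
      show "(\<lambda>n. ip (op_of (f n) x) y) \<longlonglongrightarrow> ip (op_of S x) y"
        by (intro ip.tendsto lim tendsto_const)
      have "(\<lambda>n. ip x (op_of (f n) y)) \<longlonglongrightarrow> ip x (op_of S y)"
        by (intro ip.tendsto lim tendsto_const)
      then show "(\<lambda>n. ip (op_of (f n) x) y) \<longlonglongrightarrow> ip x (op_of S y)"
        using f(1) by (simp add: adj_iff)
    qed
    then show "adj S S" by (simp add: adj_iff)
  qed
  show "(norm S)\<^sup>2 \<le> norm (T * S)" if "adj S T" for S T
  proof -
    \<comment> \<open>Cauchy-Schwarz enters here, through the square of the norm of S x being the
      norm of the inner product of x and T S x.\<close>
    have "norm (op_of S) \<le> sqrt (norm (T * S))"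
    proof (rule norm_blinfun_bound)
      fix x
      have "(norm (op_of S x))\<^sup>2 = norm (ip x (op_of (T * S) x))"
        using that by (simp add: adj_iff flip: norm_ip_self)
      also have "\<dots> \<le> norm x * (norm (T * S) * norm x)"
        using norm_blinfun[of "op_of (T * S)" x]
        by (intro order_trans[OF norm_ip_le_mult] mult_left_mono) (simp_all only: norm_op_of norm_ge_zero)
      finally have "(norm (op_of S x))\<^sup>2 \<le> (sqrt (norm (T * S)) * norm x)\<^sup>2"
        by (simp add: power_mult_distrib power2_eq_square mult_ac)
      then show "norm (op_of S x) \<le> sqrt (norm (T * S)) * norm x"
        by (rule power2_le_imp_le) simp
    qed simp
    then show ?thesis using power_mono[of "norm (op_of S)" "sqrt (norm (T * S))" 2]
      by (simp add: norm_op_of)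
  qed
qed

end

section \<open>Positivity in a C*-algebra\<close>

lemma norm_star [simp]: "norm (star (a::'a::cstar_algebra)) = norm a"
proof -
  have le: "norm b \<le> norm (star b)" for b :: 'a
  proof (cases "b = 0")
    case False
    have "norm b * norm b \<le> norm (star b) * norm b"
      using cstar_identity[of b] norm_mult_ineq[of "star b" b] by (simp add: power2_eq_square)
    then show ?thesis using False by simp
  qed simp
  show ?thesis using le[of a] le[of "star a"] by (simp add: star_star)
qed

text \<open>Over itself a C*-algebra satisfies the Cauchy-Schwarz inequality for trivial reasons.\<close>

interpretation self: cs_hilbert_module "(*)" "\<lambda>a b::'a::cstar_algebra. star a * b"
proof
  fix a b c :: 'a and z :: complex
  show "cstar_positive (star a * a)" by (auto simp: cstar_positive_def)
  show "a = 0" if "star a * a = 0" using cstar_identity[of a] that by simp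
  show "norm a = sqrt (norm (star a * a))" by (simp add: cstar_identity)
  show "norm (star a * b) \<le> norm a * norm b" using norm_mult_ineq[of "star a" b] by simp
qed (simp_all add: distrib_left distrib_right mult_scaleC_left mult_scaleC_right star_mult star_star
    mult.assoc)

definition lmult :: "'a::cstar_algebra \<Rightarrow> 'a endo" where
  "lmult a = Endo (blinfun_mult_right a)"

lemma lmult_apply [simp]: "op_of (lmult a) b = a * b"
  by (simp add: lmult_def blinfun_mult_right.rep_eq)

lemma lmult_simps:
  "lmult (a + b) = lmult a + lmult b" "lmult (a - b) = lmult a - lmult b"
  "lmult (- a) = - lmult a" "lmult (a * b) = lmult a * lmult b" "lmult 0 = 0"
  by (rule endo_eqI; simp add: algebra_simps plus_blinfun.rep_eq minus_blinfun.rep_eq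
      uminus_blinfun.rep_eq)+

lemma adj_lmult: "self.adj (lmult a) (lmult (star a))"
  by (simp add: self.adj_iff star_mult mult.assoc)

text \<open>The lower bound comes from evaluating at \<open>star a\<close>.\<close>

lemma norm_lmult [simp]: "norm (lmult a) = norm a"
proof (rule antisym)
  show "norm (lmult a) \<le> norm a"
    by (subst norm_op_of[symmetric], rule norm_blinfun_bound) (simp_all add: norm_mult_ineq)
  have "norm a * norm a = norm (a * star a)"
    using cstar_identity[of "star a"] by (simp add: star_star power2_eq_square)
  also have "\<dots> \<le> norm (lmult a) * norm a"
    using norm_blinfun[of "op_of (lmult a)" "star a"] by (simp add: norm_op_of)
  finally show "norm a \<le> norm (lmult a)"
    by (cases "a = 0") auto
qed

text \<open>
  Agrees with \<^const>\<open>cstar_positive\<close>, but closure under sums is immediate from the left regular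
  representation.
\<close>

definition cpos :: "'a::cstar_algebra \<Rightarrow> bool" where
  "cpos a \<longleftrightarrow> self.op.pos (lmult a)"

lemma cpos_add: "cpos a \<Longrightarrow> cpos b \<Longrightarrow> cpos (a + b)"
  by (simp add: cpos_def lmult_simps self.op.pos_add)

lemma cpos_zero: "cpos 0"
  by (simp add: cpos_def lmult_simps self.op.pos_zero)

lemma cpos_sum: "(\<And>i. i \<in> A \<Longrightarrow> cpos (f i)) \<Longrightarrow> cpos (\<Sum>i\<in>A. f i)"
  by (induction A rule: infinite_finite_induct) (auto simp: cpos_zero cpos_add)

lemma cpos_star_mult: "cpos (star a * a)"
  using self.op.pos_adj_mult[OF adj_lmult] by (simp add: cpos_def lmult_simps)

lemma cpos_if_cstar_positive: "cstar_positive a \<Longrightarrow> cpos a"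
  by (auto simp: cstar_positive_def cpos_star_mult)

lemma cpos_antisym: "cpos a \<Longrightarrow> cpos (- a) \<Longrightarrow> a = 0"
  using self.op.pos_antisym[of "lmult a"] norm_lmult[of a] by (simp add: cpos_def lmult_simps)

lemma cpos_norm_mono: "cpos a \<Longrightarrow> cpos (b - a) \<Longrightarrow> norm a \<le> norm b"
  using self.op.norm_mono[of "lmult a" "lmult b"] by (simp add: cpos_def lmult_simps)

text \<open>The algebra may lack a unit, so the root \<open>r\<close> of 1 - c is taken among
  operators; the difference becomes the square of \<open>r * lmult a\<close> in the sense of
  \<open>pos_adj_mult\<close>.\<close>

lemma cpos_conj_one_minus:
  assumes "star c = c" "norm c \<le> 1"
  shows "cpos (star a * a - star a * c * a)"
proof -
  have "self.adj (lmult c) (lmult c)" using adj_lmult[of c] assms by simp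
  then have "self.op.pos (1 - lmult c)"
    using assms by (intro self.op.pos_one_minus) auto
  then obtain r where r: "self.op.pos r" "r * r = 1 - lmult c"
    by (rule self.op.pos_sqrt)
  have "self.adj (r * lmult a) (lmult (star a) * r)"
    by (intro self.op.adj_mult adj_lmult self.op.pos_selfadj r)
  then have "self.op.pos (lmult (star a) * r * (r * lmult a))"
    by (rule self.op.pos_adj_mult)
  also have "lmult (star a) * r * (r * lmult a) = lmult (star a) * (r * r) * lmult a"
    by (simp add: mult.assoc)
  also have "\<dots> = lmult (star a * a - star a * c * a)"
    by (simp add: r(2) lmult_simps algebra_simps)
  finally show ?thesis by (simp add: cpos_def)
qed

section \<open>Hilbert modules over general C*-algebras\<close>

context hilbert_module
begin

lemma cpos_ip: "cpos (ip x x)"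
  by (rule cpos_if_cstar_positive[OF ip_positive])

text \<open>Expanding the inner square of z = xa - y with a = \<open>ip x y\<close> writes
  \<open>ip y y - star a * a\<close> as a sum of two positive elements; the second is positive
  because x has norm at most 1.\<close>

lemma norm_ip_le_right:
  assumes "norm x \<le> 1" shows "norm (ip x y) \<le> norm y"
proof -
  define a where "a = ip x y"
  define z where "z = act x a - y"
  have a: "star a = ip y x" by (simp add: a_def star_ip)
  have "ip y y - star a * a = ip z z + (star a * a - star a * ip x x * a)"
    by (simp add: z_def ip.diff_left ip.diff_right ip_act_left ip_act_right a algebra_simps)
      (simp add: a_def mult.assoc)
  moreover have "cpos (ip z z + (star a * a - star a * ip x x * a))"
    using assms by (intro cpos_add cpos_ip cpos_conj_one_minus)
      (simp_all add: star_ip norm_ip_self abs_square_le_1)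
  ultimately have "norm (star a * a) \<le> norm (ip y y)"
    by (intro cpos_norm_mono cpos_star_mult) simp
  then show ?thesis by (simp add: cstar_identity norm_ip_self a_def)
qed

lemma cauchy_schwarz: "norm (ip x y) \<le> norm x * norm y"
proof (cases "x = 0")
  case False
  then have "norm (ip (inverse (norm x) *\<^sub>R x) y) \<le> norm y"
    by (intro norm_ip_le_right) simp
  then show ?thesis using False by (simp add: ip_scaleR_left field_simps)
qed (simp add: ip.zero_left)

end

sublocale hilbert_module \<subseteq> cs_hilbert_module
  by unfold_locales (rule cauchy_schwarz)

context hilbert_module
begin

text \<open>With n = |T| - T, s a root of |T| and w = n x, the value of \<open>ip w (T w)\<close> is
  minus the inner square of s w. Both are positive, so s n = 0, and then n = 0.\<close>

lemma pos_iff_ip: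
  assumes T: "adj T T" and ip: "\<And>x. cpos (ip x (op_of T x))"
  shows "op.pos T"
proof -
  obtain m n s where mn: "op.pos m" "n = m - T" "n * T = - (n * m)" "n * m = m * n"
      "op.pos s" "s * s = m" "s * n = n * s"
    by (rule op.abs_minus_obtain[OF T])
  have n: "adj n n" unfolding mn(2) by (intro op.adj_diff T op.pos_selfadj mn)
  have s: "adj s s" by (intro op.pos_selfadj mn)
  have "op_of (s * n) x = 0" for x
  proof -
    define w where "w = op_of n x"
    have "n * T * n = - (n * s * (s * n))" by (simp add: mn(3) mn(6)[symmetric] mult.assoc)
    then have eq: "op_of n (op_of T w) = - op_of n (op_of s (op_of s w))"
      unfolding w_def by (metis (mono_tags) blinfun_apply_blinfun_compose op_of_simps(3,5) uminus_blinfun.rep_eq)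
    have "ip w (op_of T w) = ip x (op_of n (op_of T w))"
      using n by (simp add: w_def adj_iff)
    also have "\<dots> = - ip x (op_of n (op_of s (op_of s w)))" by (simp add: eq ip.minus_right)
    also have "\<dots> = - ip (op_of s w) (op_of s w)"
      using n s by (simp add: w_def adj_iff)
    finally have "- ip (op_of s w) (op_of s w) = ip w (op_of T w)" by simp
    then have "ip (op_of s w) (op_of s w) = 0"
      using ip[of w] by (intro cpos_antisym cpos_ip) simp
    then show ?thesis by (simp add: w_def ip_definite)
  qed
  then have "s * n = 0" by (intro endo_eqI) simp
  then have "m * n = 0" by (simp add: mn(6)[symmetric] mult.assoc)
  then have nm: "n * m = 0" using mn(4) by simp
  then have "n * n = 0" using mn(3) by (simp add: mn(2) left_diff_distrib right_diff_distrib)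
  then have "n = 0" using op.adj_eq_0[OF n] by simp
  then show ?thesis using mn(1,2) by simp
qed

end

section \<open>Compact operators\<close>

instance blinfun :: (real_normed_vector, complex_normed_vector) complex_normed_vector
proof
  have le: "norm (c *\<^sub>C f) \<le> cmod c * norm f" for c and f :: "'a \<Rightarrow>\<^sub>L 'b"
    by (rule norm_blinfun_bound)
      (simp_all add: scaleC_blinfun.rep_eq norm_scaleC mult.assoc mult_left_mono norm_blinfun)
  show "norm (c *\<^sub>C f) = cmod c * norm f" for c and f :: "'a \<Rightarrow>\<^sub>L 'b"
  proof (cases "c = 0")
    case False
    then have "norm f \<le> cmod (inverse c) * norm (c *\<^sub>C f)"
      using le[of "inverse c" "c *\<^sub>C f"] by (simp add: complex_vector.scale_scale)
    then show ?thesis using False le[of c f] by (simp add: norm_inverse norm_divide field_simps)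
  qed (use le[of 0 f] in simp)
qed

lemmas compose_simps =
  bounded_bilinear.add_left[OF bounded_bilinear_blinfun_compose]
  bounded_bilinear.add_right[OF bounded_bilinear_blinfun_compose]
  bounded_bilinear.zero_left[OF bounded_bilinear_blinfun_compose]
  bounded_bilinear.zero_right[OF bounded_bilinear_blinfun_compose]

lemma complex_subspace_closure:
  fixes S :: "'v::complex_normed_vector set"
  assumes S: "complex_vector.subspace S"
  shows "complex_vector.subspace (closure S)"
  unfolding complex_vector.subspace_def
proof (intro conjI allI ballI)
  show "0 \<in> closure S" using closure_subset complex_vector.subspace_0[OF S] by blast
  show "x + y \<in> closure S" if x: "x \<in> closure S" and y: "y \<in> closure S" for x y
  proof -
    obtain f where f: "\<forall>n. f n \<in> S" "f \<longlonglongrightarrow> x" using x unfolding closure_sequential by blast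
    obtain g where g: "\<forall>n. g n \<in> S" "g \<longlonglongrightarrow> y" using y unfolding closure_sequential by blast
    show ?thesis
      unfolding closure_sequential
      by (intro exI[of _ "\<lambda>n. f n + g n"] conjI allI tendsto_add complex_vector.subspace_add[OF S])
        (use f g in auto)
  qed
  show "c *\<^sub>C x \<in> closure S" if x: "x \<in> closure S" for c x
  proof -
    obtain f where f: "\<forall>n. f n \<in> S" "f \<longlonglongrightarrow> x" using x unfolding closure_sequential by blast
    show ?thesis
      unfolding closure_sequential
      by (intro exI[of _ "\<lambda>n. c *\<^sub>C f n"] conjI allI complex_vector.subspace_scale[OF S]
          bounded_linear.tendsto[OF bounded_linear_scaleC]) (use f in auto)
  qed
qed

lemma real_subspace_if_complex_subspace:
  "complex_vector.subspace (S :: 'v::complex_vector set) \<Longrightarrow> subspace S"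
  by (auto simp: subspace_def complex_vector.subspace_def scaleR_scaleC)

context hilbert_module
begin

definition Theta :: "'x \<Rightarrow> 'x \<Rightarrow> 'x endo" where
  "Theta y x = Endo (theta act ip y x)"

definition compact_ops :: "'x endo set" where
  "compact_ops = {T. op_of T \<in> compacts act ip}"

lemma op_of_Theta [simp]: "op_of (Theta y x) = theta act ip y x"
  by (simp add: Theta_def)

lemma adj_Theta: "adj (Theta y x) (Theta x y)"
  by (simp add: adj_iff ip_act_left ip_act_right star_ip)

lemma adj_scaleC:
  assumes "adj S T" shows "op_of S (c *\<^sub>C x) = c *\<^sub>C op_of S x"
proof -
  have "ip z (op_of S y) = ip (op_of T z) y" for y z
    using op.adj_sym[OF assms] by (simp add: adj_iff)
  then show ?thesis by (intro ip_ext) (simp add: ip_scaleC_right)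
qed

lemma adj_act:
  assumes "adj S T" shows "op_of S (act x a) = act (op_of S x) a"
proof -
  have "ip z (op_of S y) = ip (op_of T z) y" for y z
    using op.adj_sym[OF assms] by (simp add: adj_iff)
  then show ?thesis by (intro ip_ext) (simp add: ip_act_right)
qed

lemma mult_Theta: "adj S T \<Longrightarrow> S * Theta y x = Theta (op_of S y) x"
  by (rule endo_eqI) (simp add: adj_act)

lemma Theta_mult: "adj S T \<Longrightarrow> Theta y x * S = Theta y (op_of T x)"
  using op.adj_sym[of S T] by (intro endo_eqI) (simp add: adj_iff)

lemma pos_Theta: "op.pos (Theta x x)"
  by (intro pos_iff_ip adj_Theta) (simp add: ip_act_right cpos_star_mult flip: star_ip[of x])

lemma norm_Theta_le: "norm (Theta y x) \<le> norm y * norm x"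
proof (subst norm_op_of[symmetric], rule norm_blinfun_bound)
  fix z
  have "norm (act y (ip x z)) \<le> norm y * (norm x * norm z)"
    by (intro order_trans[OF norm_act_le] mult_left_mono cauchy_schwarz) simp
  then show "norm (op_of (Theta y x) z) \<le> norm y * norm x * norm z" by (simp add: mult.assoc)
qed simp

text \<open>For c = \<open>ip x x\<close>, the image of x under \<open>Theta x x\<close> has inner
  square c^3. The C*-identity gives the norm of c^4, from which the norm of c^3 is bounded
  below.\<close>

lemma norm_Theta_ge: "(norm x)\<^sup>2 \<le> norm (Theta x x)"
proof -
  define c where "c = ip x x"
  have c: "star c = c" by (simp add: c_def star_ip)
  have nc: "norm c = (norm x)\<^sup>2" by (simp add: c_def norm_ip_self)
  have cc: "norm (c * c) = norm c * norm c"
    using cstar_identity[of c] by (simp add: c power2_eq_square)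
  have "norm (c * c * (c * c)) = norm (c * c) * norm (c * c)"
    using cstar_identity[of "c * c"] by (simp add: c star_mult power2_eq_square)
  then have "norm c * norm c * (norm c * norm c) = norm (c * (c * c * c))"
    by (simp add: cc mult.assoc)
  also have "\<dots> \<le> norm c * norm (c * c * c)" by (rule norm_mult_ineq)
  also have "c * c * c = ip (op_of (Theta x x) x) (op_of (Theta x x) x)"
    by (simp add: ip_act_left ip_act_right c star_mult flip: c_def)
  also have "norm \<dots> = (norm (op_of (Theta x x) x))\<^sup>2" by (rule norm_ip_self)
  also have "\<dots> \<le> (norm (Theta x x) * norm x)\<^sup>2"
    using norm_blinfun[of "op_of (Theta x x)" x] by (intro power_mono) (simp_all only: norm_op_of norm_ge_zero)
  finally have "(norm x)\<^sup>2 * (norm x)\<^sup>2 * ((norm x)\<^sup>2 * (norm x)\<^sup>2) \<le> (norm x)\<^sup>2 * (norm (Theta x x) * norm x)\<^sup>2"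
    by (simp add: nc mult_left_mono)
  then have "((norm x)\<^sup>2 * ((norm x)\<^sup>2))\<^sup>2 \<le> ((norm x)\<^sup>2 * norm (Theta x x))\<^sup>2"
    by (simp add: power2_eq_square mult_ac)
  then have "(norm x)\<^sup>2 * ((norm x)\<^sup>2) \<le> (norm x)\<^sup>2 * norm (Theta x x)"
    by (rule power2_le_imp_le) simp
  then show ?thesis
    using mult_le_cancel_left_pos[of "(norm x)\<^sup>2" "(norm x)\<^sup>2" "norm (Theta x x)"]
    by (cases "x = 0") auto
qed

section \<open>The compact operators as a closed subalgebra\<close>

lemma complex_subspace_compacts: "complex_vector.subspace (compacts act ip)"
  unfolding compacts_def by (intro complex_subspace_closure complex_vector.subspace_span)

lemma compacts_least:
  assumes "closed M" "complex_vector.subspace M" "\<And>y x. theta act ip y x \<in> M"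
  shows "compacts act ip \<subseteq> M"
  unfolding compacts_def
  by (intro closure_minimal complex_vector.span_minimal assms) (use assms in auto)

lemma theta_in_compacts: "theta act ip y x \<in> compacts act ip"
  unfolding compacts_def
  by (rule subsetD[OF closure_subset], rule complex_vector.span_base) auto

lemma closed_compacts: "closed (compacts act ip)"
  by (simp add: compacts_def)

lemma closed_compose_compacts:
  "closed {T. S o\<^sub>L T \<in> compacts act ip}" "closed {T. T o\<^sub>L S \<in> compacts act ip}"
  by (intro closed_vimage[OF closed_compacts, unfolded vimage_def] continuous_intros)+

lemma compact_ops_mult_left:
  assumes S: "adj S S'" and T: "T \<in> compact_ops" shows "S * T \<in> compact_ops"
proof -
  have lin: "op_of S o\<^sub>L c *\<^sub>C f = c *\<^sub>C (op_of S o\<^sub>L f)" for c and f :: "'x \<Rightarrow>\<^sub>L 'x"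
    by (rule blinfun_eqI) (simp add: scaleC_blinfun.rep_eq adj_scaleC[OF S])
  have "compacts act ip \<subseteq> {T. op_of S o\<^sub>L T \<in> compacts act ip}"
  proof (rule compacts_least[OF closed_compose_compacts(1)])
    show "complex_vector.subspace {T. op_of S o\<^sub>L T \<in> compacts act ip}"
      using complex_subspace_compacts
      by (auto simp: complex_vector.subspace_def lin compose_simps)
    show "theta act ip y x \<in> {T. op_of S o\<^sub>L T \<in> compacts act ip}" for y x
      using mult_Theta[OF S, of y x] theta_in_compacts by (metis op_of_Theta op_of_simps(5) mem_Collect_eq)
  qed
  then show ?thesis using T by (auto simp: compact_ops_def)
qed

lemma compacts_compose_right:
  assumes "\<And>y x. theta act ip y x o\<^sub>L S \<in> compacts act ip" "T \<in> compacts act ip"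
  shows "T o\<^sub>L S \<in> compacts act ip"
proof -
  have lin: "c *\<^sub>C f o\<^sub>L S = c *\<^sub>C (f o\<^sub>L S)" for c and f :: "'x \<Rightarrow>\<^sub>L 'x"
    by (rule blinfun_eqI) (simp add: scaleC_blinfun.rep_eq)
  have "compacts act ip \<subseteq> {T. T o\<^sub>L S \<in> compacts act ip}"
  proof (rule compacts_least[OF closed_compose_compacts(2)])
    show "complex_vector.subspace {T. T o\<^sub>L S \<in> compacts act ip}"
      using complex_subspace_compacts
      by (auto simp: complex_vector.subspace_def lin compose_simps)
  qed (use assms in auto)
  then show ?thesis using assms by auto
qed

lemma Theta_in_compact_ops: "Theta y x \<in> compact_ops"
  by (simp add: compact_ops_def theta_in_compacts)

text \<open>For \<open>T\<close> of the form \<open>Theta y x\<close>, which is adjointable, this is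
  \<open>compact_ops_mult_left\<close>; linearity and closure extend it to all compact
  \<open>T\<close>, with no appeal to their adjointability.\<close>

lemma compact_ops_mult:
  assumes "T \<in> compact_ops" "S \<in> compact_ops" shows "T * S \<in> compact_ops"
  using assms compact_ops_mult_left[OF adj_Theta assms(2)] compacts_compose_right[of "op_of S" "op_of T"]
  by (simp add: compact_ops_def)

lemma closed_subalgebra_compact_ops: "closed_subalgebra compact_ops"
proof -
  have "closed compact_ops"
    unfolding compact_ops_def
    by (intro closed_vimage[OF closed_compacts, unfolded vimage_def]
        linear_continuous_on bounded_linear_op_of)
  moreover have "subspace compact_ops"
    using real_subspace_if_complex_subspace[OF complex_subspace_compacts]
    by (auto simp: subspace_def compact_ops_def)
  ultimately show ?thesis using compact_ops_mult by (simp add: closed_subalgebra_def)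
qed

lemma subspace_compact_ops: "subspace compact_ops"
  using closed_subalgebra_compact_ops by (simp add: closed_subalgebra_def)

text \<open>Translates the factorization that defines positivity into the norm criterion.
  Conversely, the root of a compact operator is compact because \<open>compact_ops\<close> is a
  closed subalgebra.\<close>

lemma compact_positive_iff:
  "compact_positive act ip (op_of T) \<longleftrightarrow> T \<in> compact_ops \<and> op.pos T"
proof
  assume "compact_positive act ip (op_of T)"
  then obtain S S' where S: "S \<in> compacts act ip" "S' \<in> compacts act ip" "is_adjoint ip S S'"
      "op_of T = S' o\<^sub>L S"
    by (auto simp: compact_positive_def)
  have T: "T = Endo S' * Endo S" using S(4) by (intro endo_eqI) simp
  have "Endo S' * Endo S \<in> compact_ops"
    using S by (intro compact_ops_mult) (simp_all add: compact_ops_def)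
  moreover have "op.pos (Endo S' * Endo S)"
    using S(3) by (intro op.pos_adj_mult) (simp add: adj_def)
  ultimately show "T \<in> compact_ops \<and> op.pos T" by (simp add: T)
next
  assume T: "T \<in> compact_ops \<and> op.pos T"
  obtain r where r: "op.pos r" "r * r = T" "\<forall>K. closed_subalgebra K \<longrightarrow> T \<in> K \<longrightarrow> r \<in> K"
    by (rule op.pos_sqrt[OF conjunct2[OF T]]) (rule that)
  have "r \<in> compact_ops" using r(3) T closed_subalgebra_compact_ops by blast
  moreover have "op_of T = op_of r o\<^sub>L op_of r" using r(2) by auto
  ultimately show "compact_positive act ip (op_of T)"
    using op.pos_selfadj[OF r(1)] unfolding compact_positive_def compact_ops_def adj_def by blast
qed

lemma compact_le_iff:
  "compact_le act ip (op_of S) (op_of T) \<longleftrightarrow> S \<in> compact_ops \<and> T \<in> compact_ops \<and> op.pos (T - S)"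
  using compact_positive_iff[of "T - S"] subspace_diff[OF subspace_compact_ops, of T S]
  by (auto simp: compact_le_def compact_ops_def)

text \<open>Complex coefficients are absorbed into the left vector.\<close>

lemma span_theta_sum_list:
  assumes "T \<in> complex_vector.span {theta act ip y x | y x. True}"
  shows "\<exists>ps. T = (\<Sum>(y, x)\<leftarrow>ps. theta act ip y x)"
  using assms
proof (induction rule: complex_vector.span_induct_alt)
  case base
  show ?case by (intro exI[of _ "[]"]) simp
next
  case (step c T S)
  then obtain ps y x where ps: "S = (\<Sum>(y, x)\<leftarrow>ps. theta act ip y x)" and T: "T = theta act ip y x"
    by auto
  have "c *\<^sub>C T = theta act ip (c *\<^sub>C y) x"
    unfolding T by (rule blinfun_eqI) (simp add: scaleC_blinfun.rep_eq act_scaleC_left)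
  then show ?case by (intro exI[of _ "(c *\<^sub>C y, x) # ps"]) (simp add: ps)
qed

lemma compact_ops_approx:
  assumes "T \<in> compact_ops" "e > 0"
  obtains ps where "norm (T - (\<Sum>(y, x)\<leftarrow>ps. Theta y x)) < e"
proof -
  obtain S where S: "S \<in> complex_vector.span {theta act ip y x | y x. True}" "dist S (op_of T) < e"
    using assms unfolding compact_ops_def compacts_def by (auto simp: closure_approachable)
  obtain ps where ps: "S = (\<Sum>(y, x)\<leftarrow>ps. theta act ip y x)"
    using span_theta_sum_list[OF S(1)] by blast
  have "op_of (\<Sum>(y, x)\<leftarrow>ps. Theta y x) = S"
    unfolding ps by (induction ps) auto
  then have "norm (T - (\<Sum>(y, x)\<leftarrow>ps. Theta y x)) < e"
    using S(2) by (simp add: dist_norm norm_minus_commute flip: norm_op_of)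
  then show thesis by (rule that)
qed

end

section \<open>Approximation from below by sums of rank-one operators\<close>

context star_relation
begin

lemma pos_conj:
  assumes "pos a" "adj u u'" shows "pos (u' * a * u)"
proof -
  obtain r where r: "pos r" "r * r = a"
    by (rule pos_sqrt[OF assms(1)]) (rule that)
  have "pos (u' * r * (r * u))"
    by (intro pos_adj_mult adj_mult assms pos_selfadj r)
  also have "u' * r * (r * u) = u' * a * u" by (simp add: mult.assoc flip: r(2))
  finally show ?thesis .
qed

lemma norm_power_one_minus_le:
  assumes "pos h" "norm h \<le> 1" shows "norm ((1 - h) ^ n) \<le> 1"
proof (induction n)
  case 0
  show ?case using norm_one_le by simp
next
  case (Suc n)
  have "norm ((1 - h) ^ Suc n) \<le> norm (1 - h) * norm ((1 - h) ^ n)"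
    by (simp add: norm_mult_ineq)
  also have "\<dots> \<le> 1 * 1"
    by (intro mult_mono norm_one_minus_le assms Suc) auto
  finally show ?case by simp
qed

end

context hilbert_module
begin

text \<open>Put u = (1 - h)^k and y = u x. Conjugating the hypothesis by u shows that d times
  \<open>Theta y y\<close> is below (1 - h)^(2k) h, whose norm is at most 1/(2k);
  \<open>norm_Theta_ge\<close> turns this into a bound on y.\<close>

lemma power_one_minus_tendsto_0:
  assumes h: "op.pos h" "norm h \<le> 1" and d: "d > 0" and le: "op.pos (h - d *\<^sub>R Theta x x)"
  shows "(\<lambda>k. op_of ((1 - h) ^ k) x) \<longlonglongrightarrow> 0"
proof -
  have "(norm (op_of ((1 - h) ^ k) x))\<^sup>2 \<le> inverse d * inverse (real k)" if "k > 0" for k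
  proof -
    define u where "u = (1 - h) ^ k"
    define y where "y = op_of u x"
    have u: "adj u u" unfolding u_def
      by (intro op.adj_power op.adj_diff op.adj_one op.pos_selfadj h)
    have q: "op.pos (1 - h)" using h by (intro op.pos_one_minus op.pos_selfadj)
    have comm: "h * u = u * h" unfolding u_def
      by (rule power_commuting_commutes[symmetric]) (simp add: algebra_simps)
    have eq: "u * (h - d *\<^sub>R Theta x x) * u = u * h * u - d *\<^sub>R Theta y y"
      by (simp add: right_diff_distrib left_diff_distrib mult_Theta[OF u] Theta_mult[OF u] y_def)
    have "d * (norm y)\<^sup>2 \<le> norm (d *\<^sub>R Theta y y)"
      using d norm_Theta_ge[of y] by simp
    also have "\<dots> \<le> norm (u * h * u)"
      using op.pos_conj[OF le u] d unfolding eq by (intro op.norm_mono op.pos_scaleR pos_Theta) auto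
    also have "u * h * u = (1 - h) ^ (k + k) * h"
      by (simp add: power_add mult.assoc comm flip: u_def)
    finally have "real (k + k) * (d * (norm y)\<^sup>2) \<le> 1"
      using op.norm_power_mult_le[OF h(1) q, of "k + k"]
      by (meson mult_left_mono of_nat_0_le_iff order_trans)
    moreover have "real k * (d * (norm y)\<^sup>2) \<le> real (k + k) * (d * (norm y)\<^sup>2)"
      using d by (intro mult_right_mono) auto
    ultimately have "real k * (d * (norm y)\<^sup>2) \<le> 1" by simp
    then show ?thesis using d that by (simp add: y_def u_def field_simps)
  qed
  then have "eventually (\<lambda>k. norm ((norm (op_of ((1 - h) ^ k) x))\<^sup>2) \<le> inverse d * inverse (real k)) sequentially"
    by (intro eventually_mono[OF eventually_gt_at_top[of 0]]) simp
  moreover have "(\<lambda>k. inverse d * inverse (real k)) \<longlonglongrightarrow> 0"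
    by (intro tendsto_mult_right_zero lim_inverse_n)
  ultimately have "(\<lambda>k. (norm (op_of ((1 - h) ^ k) x))\<^sup>2) \<longlonglongrightarrow> 0"
    by (rule Lim_null_comparison)
  then have "(\<lambda>k. sqrt ((norm (op_of ((1 - h) ^ k) x))\<^sup>2)) \<longlonglongrightarrow> sqrt 0"
    by (rule tendsto_real_sqrt)
  then show ?thesis by (simp add: tendsto_norm_zero_iff)
qed

section \<open>The cone of finite sums of operators \<open>Theta y y\<close>\<close>

definition Theta_sums :: "'x endo set" where
  "Theta_sums = range (\<lambda>ys. \<Sum>y\<leftarrow>ys. Theta y y)"

lemma Theta_sums_add: "S \<in> Theta_sums \<Longrightarrow> T \<in> Theta_sums \<Longrightarrow> S + T \<in> Theta_sums"
  unfolding Theta_sums_def by (auto intro: range_eqI[of _ _ "_ @ _"])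

lemma Theta_sums_zero: "0 \<in> Theta_sums"
  unfolding Theta_sums_def by (rule range_eqI[of _ _ "[]"]) simp

text \<open>Conjugating \<open>Theta y y\<close> by \<open>S\<close> replaces y by S y.\<close>

lemma Theta_sums_conj:
  assumes S: "adj S S'" and T: "T \<in> Theta_sums" shows "S * T * S' \<in> Theta_sums"
proof -
  obtain ys where ys: "T = (\<Sum>y\<leftarrow>ys. Theta y y)" using T by (auto simp: Theta_sums_def)
  have "S * T * S' = (\<Sum>y\<leftarrow>map (op_of S) ys. Theta y y)"
    unfolding ys
    by (induction ys)
      (simp_all add: distrib_left distrib_right mult_Theta[OF S] Theta_mult[OF op.adj_sym[OF S]])
  then show ?thesis unfolding Theta_sums_def by blast
qed

lemma Theta_sums_scaleR:
  assumes "T \<in> Theta_sums" "d \<ge> 0" shows "d *\<^sub>R T \<in> Theta_sums"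
  using Theta_sums_conj[OF op.adj_scaleR[OF op.adj_one, of "sqrt d"] assms(1)] assms(2) by simp

lemma pos_Theta_sum_list: "op.pos (\<Sum>y\<leftarrow>ys. Theta y y)"
  by (induction ys) (auto intro: op.pos_zero op.pos_add pos_Theta)

lemma Theta_sum_list_compact: "(\<Sum>y\<leftarrow>ys. Theta y y) \<in> compact_ops"
  by (induction ys)
    (auto intro: subspace_add[OF subspace_compact_ops] subspace_0[OF subspace_compact_ops] Theta_in_compact_ops)

text \<open>The increment (1 - h)^k h has to be seen as a conjugate of h: it equals q^k h q^k for a
  root q of 1 - h that commutes with h.\<close>

lemma one_minus_power_in_Theta_sums:
  assumes h: "op.pos h" "norm h \<le> 1" "h \<in> Theta_sums"
  shows "1 - (1 - h) ^ k \<in> Theta_sums"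
proof (induction k)
  case (Suc k)
  have "op.pos (1 - h)" using h by (intro op.pos_one_minus op.pos_selfadj)
  then obtain q where q: "op.pos q" "q * q = 1 - h"
      "\<forall>b. b * (1 - h) = (1 - h) * b \<longrightarrow> b * q = q * b"
    by (rule op.pos_sqrt) (rule that)
  have hq: "h * q = q * h" by (rule q(3)[rule_format]) (simp add: algebra_simps)
  have comm: "q ^ k * h = h * q ^ k" by (rule power_commuting_commutes) (simp add: hq)
  have sq: "(1 - h) ^ k = q ^ k * q ^ k"
  proof -
    have "(q * q) ^ k = q ^ (2 * k)" by (simp only: power_mult power2_eq_square)
    also have "\<dots> = q ^ k * q ^ k" by (simp only: mult_2 power_add)
    finally show ?thesis by (simp only: q(2))
  qed
  have "(1 - h) ^ k * h = q ^ k * (q ^ k * h)" by (simp only: sq mult.assoc)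
  also have "\<dots> = q ^ k * h * q ^ k" by (subst comm) (rule mult.assoc[symmetric])
  finally have "(1 - h) ^ Suc k = (1 - h) ^ k - q ^ k * h * q ^ k"
    by (simp only: power_Suc2 right_diff_distrib mult_1_right)
  then have "1 - (1 - h) ^ Suc k = 1 - (1 - h) ^ k + q ^ k * h * q ^ k" by (simp only:) simp
  also have "\<dots> \<in> Theta_sums"
    by (intro Theta_sums_add Suc Theta_sums_conj h op.adj_power op.pos_selfadj q)
  finally show ?case .
qed (simp add: Theta_sums_zero)

text \<open>
  With \<open>r = \<surd>T\<close> close to a finite rank operator whose range is spanned by vectors \<open>a\<close>, and \<open>h\<close> a multiple
  of \<open>\<Sum>\<theta>\<^bsub>a,a\<^esub>\<close>, the operators \<open>1 - (1 - h)\<^sup>k\<close> are sums of \<open>\<theta>\<^bsub>z,z\<^esub>\<close> and act almost as a unit on \<open>r\<close>.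
\<close>

lemma approx_from_below:
  assumes T: "op.pos T" "T \<in> compact_ops" and e: "e > 0"
  obtains ys where "op.pos (T - (\<Sum>y\<leftarrow>ys. Theta y y))" "norm (T - (\<Sum>y\<leftarrow>ys. Theta y y)) < e"
proof -
  obtain r where r: "op.pos r" "r * r = T" "\<forall>K. closed_subalgebra K \<longrightarrow> T \<in> K \<longrightarrow> r \<in> K"
    by (rule op.pos_sqrt[OF T(1)]) (rule that)
  have rK: "r \<in> compact_ops" using r(3) T(2) closed_subalgebra_compact_ops by blast
  have ra: "adj r r" using r(1) by (rule op.pos_selfadj)
  \<comment> \<open>The final error is at most the norm of \<open>r\<close> times 2
    \<delta>.\<close>
  define \<delta> where "\<delta> = e / (2 * (norm r + 1))"
  have \<delta>: "\<delta> > 0" using e by (simp add: \<delta>_def add_nonneg_pos)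
  obtain ps where ps: "norm (r - (\<Sum>(a, b)\<leftarrow>ps. Theta a b)) < \<delta>"
    using compact_ops_approx[OF rK \<delta>] by blast
  define g where "g = (\<Sum>(a, b)\<leftarrow>ps. Theta a b)"
  \<comment> \<open>The left vectors suffice, since u times \<open>Theta a b\<close> is
    \<open>Theta (u a) b\<close>.\<close>
  define H where "H = (\<Sum>a\<leftarrow>map fst ps. Theta a a)"
  define d where "d = inverse (norm H + 1)"
  define h where "h = d *\<^sub>R H"
  have d: "d > 0" by (simp add: d_def add_nonneg_pos)
  have h: "op.pos h" "norm h \<le> 1" "h \<in> Theta_sums"
  proof -
    show "op.pos h" unfolding h_def H_def using d by (intro op.pos_scaleR pos_Theta_sum_list) simp
    show "norm h \<le> 1" by (simp add: h_def d_def field_simps divide_le_eq_1 add_pos_nonneg)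
    have "H \<in> Theta_sums" unfolding H_def Theta_sums_def by (rule rangeI)
    then show "h \<in> Theta_sums" unfolding h_def using d by (intro Theta_sums_scaleR) simp_all
  qed
  have decay: "(\<lambda>k. op_of ((1 - h) ^ k) a) \<longlonglongrightarrow> 0" if a: "a \<in> set (map fst ps)" for a
  proof (rule power_one_minus_tendsto_0[OF h(1,2) d])
    obtain xs zs where split: "map fst ps = xs @ a # zs" using split_list[OF a] by blast
    have "op.pos (d *\<^sub>R ((\<Sum>a\<leftarrow>xs. Theta a a) + (\<Sum>a\<leftarrow>zs. Theta a a)))"
      using d by (intro op.pos_scaleR op.pos_add pos_Theta_sum_list) simp
    then show "op.pos (h - d *\<^sub>R Theta a a)"
      by (simp add: h_def H_def split algebra_simps)
  qed
  have uadj: "adj ((1 - h) ^ k) ((1 - h) ^ k)" for k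
    by (intro op.adj_power op.adj_diff op.adj_one op.pos_selfadj h)
  \<comment> \<open>Stated for sublists so that \<open>decay\<close>, which concerns members of
    \<open>ps\<close>, remains available in the induction.\<close>
  have "(\<lambda>k. (1 - h) ^ k * (\<Sum>(a, b)\<leftarrow>qs. Theta a b)) \<longlonglongrightarrow> 0" if "set qs \<subseteq> set ps" for qs
    using that
  proof (induction qs)
    case (Cons p qs)
    obtain a b where p: "p = (a, b)" by fastforce
    have "(\<lambda>k. op_of ((1 - h) ^ k) a) \<longlonglongrightarrow> 0" using Cons(2) p by (intro decay) force
    then have "(\<lambda>k. norm (op_of ((1 - h) ^ k) a) * norm b) \<longlonglongrightarrow> 0"
      by (intro tendsto_mult_left_zero tendsto_norm_zero)
    then have "(\<lambda>k. (1 - h) ^ k * Theta a b) \<longlonglongrightarrow> 0"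
      by (rule Lim_null_comparison[rotated]) (simp add: mult_Theta[OF uadj] norm_Theta_le)
    then show ?case using tendsto_add[OF _ Cons(1)] Cons(2) by (fastforce simp: p distrib_left)
  qed simp
  then have "(\<lambda>k. (1 - h) ^ k * g) \<longlonglongrightarrow> 0" by (simp add: g_def)
  then obtain k where k: "norm ((1 - h) ^ k * g) < \<delta>"
    using \<delta> by (metis LIMSEQ_iff diff_zero order_refl)
  define u where "u = (1 - h) ^ k"
  have "u * r = u * (r - g) + u * g" by (simp add: right_diff_distrib)
  then have "norm (u * r) \<le> norm u * norm (r - g) + norm (u * g)"
    by (metis add_mono_thms_linordered_semiring(3) norm_mult_ineq norm_triangle_mono order_refl)
  also have "norm u * norm (r - g) \<le> 1 * norm (r - g)"
    unfolding u_def by (intro mult_right_mono op.norm_power_one_minus_le h) simp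
  finally have "norm (u * r) \<le> 2 * \<delta>" using ps k by (simp add: g_def u_def)
  then have "norm r * norm (u * r) \<le> norm r * (2 * \<delta>)" by (intro mult_left_mono) auto
  also have "\<dots> < e" using e by (simp add: \<delta>_def field_simps add_pos_nonneg)
  finally have small: "norm (r * u * r) < e"
    using norm_mult_ineq[of r "u * r"] by (simp add: mult.assoc)
  have "r * (1 - u) * r \<in> Theta_sums"
    unfolding u_def by (intro Theta_sums_conj ra one_minus_power_in_Theta_sums h)
  then obtain ys where ys: "r * (1 - u) * r = (\<Sum>y\<leftarrow>ys. Theta y y)" by (auto simp: Theta_sums_def)
  \<comment> \<open>The remainder is a conjugate of the positive \<open>u\<close>, hence positive,
    and it is small since \<open>u\<close> nearly annihilates \<open>r\<close>.\<close>
  have diff: "T - (\<Sum>y\<leftarrow>ys. Theta y y) = r * u * r"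
    unfolding ys[symmetric] r(2)[symmetric] by (simp add: algebra_simps)
  have "op.pos u" unfolding u_def
    using h by (intro op.pos_power op.pos_one_minus op.pos_selfadj)
  then have "op.pos (r * u * r)" by (rule op.pos_conj[OF _ ra])
  then show thesis using that[of ys] small by (simp add: diff)
qed

text \<open>The vector v is nearly F v for the compact operator F = 1 - (1 - h)^k, with h a multiple
  of \<open>Theta v v\<close>. On F v convergence follows from that of E_N F; the remainder is
  controlled by the norm bound on E_N.\<close>

lemma approx_unit_tendsto:
  assumes E1: "\<And>N. N \<ge> 1 \<Longrightarrow> norm (E N) \<le> 1"
    and E2: "\<And>T. T \<in> compacts act ip \<Longrightarrow> (\<lambda>N. E N o\<^sub>L T) \<longlonglongrightarrow> T"
  shows "(\<lambda>N. blinfun_apply (E N) v) \<longlonglongrightarrow> v"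
proof (rule LIMSEQ_I)
  fix e :: real assume e: "e > 0"
  define d where "d = inverse (norm (Theta v v) + 1)"
  define h where "h = d *\<^sub>R Theta v v"
  have d: "d > 0" by (simp add: d_def add_nonneg_pos)
  have h: "op.pos h" "norm h \<le> 1" "h \<in> Theta_sums"
  proof -
    show "op.pos h" unfolding h_def using d by (intro op.pos_scaleR pos_Theta) simp
    show "norm h \<le> 1" by (simp add: h_def d_def field_simps divide_le_eq_1 add_pos_nonneg)
    show "h \<in> Theta_sums" unfolding h_def using d
      by (intro Theta_sums_scaleR) (auto simp: Theta_sums_def intro: range_eqI[of _ _ "[v]"])
  qed
  have "(\<lambda>k. op_of ((1 - h) ^ k) v) \<longlonglongrightarrow> 0"
    by (rule power_one_minus_tendsto_0[OF h(1,2) d]) (simp add: h_def op.pos_zero)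
  then obtain k where k: "norm (op_of ((1 - h) ^ k) v) < e / 3"
    using e by (metis LIMSEQ_iff diff_zero order_refl zero_less_divide_iff zero_less_numeral)
  define F where "F = op_of (1 - (1 - h) ^ k)"
  define w where "w = op_of ((1 - h) ^ k) v"
  have v: "v = F v + w" by (simp add: F_def w_def minus_blinfun.rep_eq)
  have "F \<in> compacts act ip"
  proof -
    have "1 - (1 - h) ^ k \<in> compact_ops"
      using one_minus_power_in_Theta_sums[OF h, of k] Theta_sum_list_compact
      unfolding Theta_sums_def by (elim rangeE) (simp only:)
    then show ?thesis by (simp only: F_def compact_ops_def mem_Collect_eq)
  qed
  from blinfun.tendsto[OF E2[OF this] tendsto_const[of v]]
  have "(\<lambda>N. E N (F v)) \<longlonglongrightarrow> F v" by simp
  then obtain M where M: "\<And>N. N \<ge> M \<Longrightarrow> norm (E N (F v) - F v) < e / 3"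
    using e LIMSEQ_D[of _ _ "e / 3"] by (metis zero_less_divide_iff zero_less_numeral)
  show "\<exists>M. \<forall>N\<ge>M. norm (E N v - v) < e"
  proof (intro exI allI impI)
    fix N assume N: "N \<ge> max M 1"
    have eq: "E N v - v = (E N (F v) - F v) + (E N w - w)"
      by (subst (1 2) v) (simp add: blinfun.add_right)
    have "norm (E N v - v) \<le> norm (E N (F v) - F v) + (norm (E N w) + norm w)"
      unfolding eq using norm_triangle_ineq[of "E N (F v) - F v" "E N w - w"] norm_triangle_ineq4[of "E N w" w]
      by linarith
    moreover have "norm (E N w) \<le> 1 * norm w"
      using norm_blinfun[of "E N" w] E1[of N] N by (meson max.boundedE mult_right_mono norm_ge_zero order_trans)
    ultimately show "norm (E N v - v) < e" using M[of N] N k by (simp add: w_def)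
  qed
qed

end

section \<open>Frames from approximate units\<close>

context hilbert_module
begin

text \<open>Passing from \<open>N\<close> to \<open>N + 1\<close> adds vectors approximating \<open>E\<^sub>N\<^sub>+\<^sub>1 - \<Sum>\<theta> = (E\<^sub>N\<^sub>+\<^sub>1 - E\<^sub>N) + (E\<^sub>N - \<Sum>\<theta>) \<ge> 0\<close>.\<close>

lemma Theta_sum_list_sequence:
  assumes K: "\<And>n. E n \<in> compact_ops" and pos: "op.pos (E 0)"
    and mono: "\<And>n. op.pos (E (Suc n) - E n)" and e: "\<And>n. e n > (0::real)"
  shows "\<exists>L. L 0 \<noteq> [] \<and> (\<forall>n. \<exists>ys. ys \<noteq> [] \<and> L (Suc n) = L n @ ys) \<and>
    (\<forall>n. op.pos (E n - (\<Sum>y\<leftarrow>L n. Theta y y)) \<and> norm ((\<Sum>y\<leftarrow>L n. Theta y y) - E n) < e n)"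
proof -
  have step: "\<exists>ys. ys \<noteq> [] \<and> op.pos (T - (\<Sum>y\<leftarrow>ys. Theta y y)) \<and> norm ((\<Sum>y\<leftarrow>ys. Theta y y) - T) < d"
    if T: "op.pos T" "T \<in> compact_ops" and d: "d > 0" for T d
  proof -
    obtain ys where ys: "op.pos (T - (\<Sum>y\<leftarrow>ys. Theta y y))" "norm (T - (\<Sum>y\<leftarrow>ys. Theta y y)) < d"
      by (rule approx_from_below[OF T d])
    \<comment> \<open>A zero vector is prepended to make every block nonempty, so that
      \<open>p\<close> becomes strictly increasing.\<close>
    have "Theta 0 0 = 0" by (rule endo_eqI) (simp add: act.zero_left)
    then show ?thesis
      using ys by (intro exI[of _ "0 # ys"]) (simp add: norm_minus_commute)
  qed
  define P where "P n l \<longleftrightarrow> l \<noteq> [] \<and> op.pos (E n - (\<Sum>y\<leftarrow>l. Theta y y)) \<and> norm ((\<Sum>y\<leftarrow>l. Theta y y) - E n) < e n"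
    for n l
  have "\<exists>L. \<forall>n. P n (L n) \<and> (\<exists>ys. ys \<noteq> [] \<and> L (Suc n) = L n @ ys)"
  proof (rule dependent_nat_choice)
    show "\<exists>l. P 0 l" using step[OF pos K e] by (simp add: P_def)
  next
    fix l n assume l: "P n l"
    define T where "T = E (Suc n) - (\<Sum>y\<leftarrow>l. Theta y y)"
    have "op.pos (E (Suc n) - E n + (E n - (\<Sum>y\<leftarrow>l. Theta y y)))"
      using l by (intro op.pos_add mono) (simp add: P_def)
    then have "op.pos T" by (simp add: T_def)
    moreover have "T \<in> compact_ops"
      unfolding T_def by (intro subspace_diff[OF subspace_compact_ops] K Theta_sum_list_compact)
    ultimately obtain ys where ys: "ys \<noteq> []" "op.pos (T - (\<Sum>y\<leftarrow>ys. Theta y y))"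
        "norm ((\<Sum>y\<leftarrow>ys. Theta y y) - T) < e (Suc n)"
      using step[of T "e (Suc n)"] e by blast
    have "P (Suc n) (l @ ys)"
      using ys by (simp add: P_def T_def algebra_simps)
    then show "\<exists>l'. P (Suc n) l' \<and> (\<exists>ys. ys \<noteq> [] \<and> l' = l @ ys)" using ys(1) by blast
  qed
  then obtain L where "\<And>n. P n (L n)" "\<And>n. \<exists>ys. ys \<noteq> [] \<and> L (Suc n) = L n @ ys" by blast
  then show ?thesis by (intro exI[of _ L]) (simp add: P_def)
qed

lemma approx_unit_frame_exists:
  assumes E: "increasing_approx_unit act ip E"
  shows "\<exists>(x :: nat \<Rightarrow> 'x) (p :: nat \<Rightarrow> nat). 1 \<le> p 1 \<and> strict_mono_on {1..} p \<and>
    (\<forall>N\<ge>1. compact_le act ip (\<Sum>n=1..p N. theta act ip (x n) (x n)) (E N) \<and>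
      norm ((\<Sum>n=1..p N. theta act ip (x n) (x n)) - E N) < 1 / real N)"
proof -
  have le: "compact_le act ip (E M) (E N)" if "1 \<le> M" "M \<le> N" for M N
    using E that by (simp add: increasing_approx_unit_def)
  \<comment> \<open>The list construction counts from 0 while \<open>E\<close> counts from 1, hence
    the shift.\<close>
  have 1: "Endo (E (Suc n)) \<in> compact_ops" for n
    using E by (simp add: increasing_approx_unit_def compact_ops_def)
  have 2: "op.pos (Endo (E (Suc 0)))"
    using E compact_positive_iff[of "Endo (E (Suc 0))"] by (simp add: increasing_approx_unit_def)
  have 3: "op.pos (Endo (E (Suc (Suc n))) - Endo (E (Suc n)))" for n
    using le[of "Suc n" "Suc (Suc n)"] compact_le_iff[of "Endo (E (Suc n))" "Endo (E (Suc (Suc n)))"]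
    by simp
  have 4: "1 / real (Suc n) > 0" for n by simp
  obtain L where L0: "L 0 \<noteq> []" and L': "\<forall>n. \<exists>ys. ys \<noteq> [] \<and> L (Suc n) = L n @ ys"
      and L: "\<forall>n. op.pos (Endo (E (Suc n)) - (\<Sum>y\<leftarrow>L n. Theta y y)) \<and>
        norm ((\<Sum>y\<leftarrow>L n. Theta y y) - Endo (E (Suc n))) < 1 / real (Suc n)"
    using Theta_sum_list_sequence[of "\<lambda>n. Endo (E (Suc n))" "\<lambda>n. 1 / real (Suc n)", OF 1 2 3 4]
    by (elim exE conjE) (rule that)
  have mono: "strict_mono (\<lambda>n. length (L n))"
    unfolding strict_mono_Suc_iff using L' by (metis length_append length_greater_0_conv less_add_same_cancel1)
  have len: "n < length (L n)" for n
  proof (induction n)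
    case (Suc n)
    then show ?case using strict_monoD[OF mono, of n "Suc n"] by simp
  qed (use L0 in simp)
  have prefix: "\<exists>ys. L (n + k) = L n @ ys" for n k
    by (induction k) (use L' in \<open>auto, metis append_assoc\<close>)
  have nth: "L m ! i = L n ! i" if "i < length (L m)" "i < length (L n)" for i m n
    using that prefix[of m "n - m"] prefix[of n "m - n"]
    by (cases "m \<le> n") (auto simp: nth_append)
  \<comment> \<open>The lists extend one another, so any long enough one determines the n-th vector,
    and \<open>L n\<close> has more than \<open>n\<close> entries. Lists are indexed from 0, the
    sequence from 1.\<close>
  define x where "x n = L n ! (n - 1)" for n
  define p where "p N = length (L (N - 1))" for N
  have sum_nth: "(\<Sum>n=1..length l. f (l ! (n - 1))) = (\<Sum>y\<leftarrow>l. f y)" for l :: "'x list" and f :: "'x \<Rightarrow> 'x \<Rightarrow>\<^sub>L 'x"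
  proof (induction l rule: rev_induct)
    case (snoc y l)
    have "(\<Sum>n=1..length l. f ((l @ [y]) ! (n - 1))) = (\<Sum>n=1..length l. f (l ! (n - 1)))"
      by (intro sum.cong) (auto simp: nth_append)
    then show ?case using snoc by simp
  qed simp
  have op_sum: "(\<Sum>y\<leftarrow>l. theta act ip y y) = op_of (\<Sum>y\<leftarrow>l. Theta y y)" for l
    by (induction l) simp_all
  have sum_eq: "(\<Sum>n=1..p (Suc N). theta act ip (x n) (x n)) = op_of (\<Sum>y\<leftarrow>L N. Theta y y)" for N
  proof -
    have "x n = L N ! (n - 1)" if "n \<in> {1..p (Suc N)}" for n
      unfolding x_def using that len[of n] by (intro nth) (auto simp: p_def)
    then have "(\<Sum>n=1..p (Suc N). theta act ip (x n) (x n))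
        = (\<Sum>n=1..length (L N). theta act ip (L N ! (n - 1)) (L N ! (n - 1)))"
      by (intro sum.cong) (simp_all add: p_def)
    also have "\<dots> = (\<Sum>y\<leftarrow>L N. theta act ip y y)" by (rule sum_nth)
    also have "\<dots> = op_of (\<Sum>y\<leftarrow>L N. Theta y y)" by (rule op_sum)
    finally show ?thesis .
  qed
  show ?thesis
  proof (intro exI conjI allI impI)
    show "1 \<le> p 1" using L0 by (simp add: p_def Suc_le_eq)
    show "strict_mono_on {1..} p"
      by (intro strict_mono_onI) (auto simp: p_def intro: strict_monoD[OF mono])
    fix N :: nat assume "1 \<le> N"
    then obtain M where N: "N = Suc M" by (cases N) auto
    show "compact_le act ip (\<Sum>n=1..p N. theta act ip (x n) (x n)) (E N)"
      unfolding N sum_eq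
      using compact_le_iff[of "\<Sum>y\<leftarrow>L M. Theta y y" "Endo (E (Suc M))"] L 1[of M] Theta_sum_list_compact
      by simp
    show "norm ((\<Sum>n=1..p N. theta act ip (x n) (x n)) - E N) < 1 / real N"
      unfolding N sum_eq using L[rule_format, of M] by (simp flip: norm_op_of)
  qed
qed

text \<open>A priori the partial sums converge along \<open>p\<close> only. Between two values of
  \<open>p\<close> they are controlled by \<open>cpos_norm_mono\<close>, because their increments
  are positive in the algebra.\<close>

lemma approx_unit_parseval_frame:
  assumes E: "increasing_approx_unit act ip E"
    and p: "strict_mono_on {1..} (p :: nat \<Rightarrow> nat)"
    and close: "\<And>N. N \<ge> 1 \<Longrightarrow> norm ((\<Sum>n=1..p N. theta act ip (x n) (x n)) - E N) < 1 / real N"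
  shows "parseval_frame ip x"
  unfolding parseval_frame_def
proof
  fix v
  define f where "f n = ip v (x n) * ip (x n) v" for n
  define a where "a n = (\<Sum>i=1..n. f i)" for n
  define S where "S n = (\<Sum>i=1..n. theta act ip (x i) (x i))" for n
  have a_eq: "a n = ip v (S n v)" for n
    by (simp add: a_def S_def f_def blinfun.sum_left ip.sum_right ip_act_right)
  have f_pos: "cpos (f n)" for n
    using cpos_star_mult[of "ip (x n) v"] by (simp add: f_def star_ip)
  have mono: "norm (a n - a m) \<le> norm (a k - a m)" if "m \<le> n" "n \<le> k" for m n k
  proof (rule cpos_norm_mono)
    have diff: "cpos (a n - a m)" if "m \<le> n" for m n
    proof -
      have "{1..n} = {1..m} \<union> {Suc m..n}" using that by auto
      then have "a n = a m + (\<Sum>i=Suc m..n. f i)"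
        unfolding a_def by (simp add: sum.union_disjoint)
      then show ?thesis using f_pos by (simp add: cpos_sum)
    qed
    show "cpos (a n - a m)" by (rule diff[OF that(1)])
    show "cpos ((a k - a m) - (a n - a m))" using diff[OF that(2)] by simp
  qed
  have Ev: "(\<lambda>N. E N v) \<longlonglongrightarrow> v"
    using E by (intro approx_unit_tendsto) (auto simp: increasing_approx_unit_def)
  have "(\<lambda>N. S (p N) - E N) \<longlonglongrightarrow> 0"
  proof (rule Lim_null_comparison)
    show "eventually (\<lambda>N. norm (S (p N) - E N) \<le> 1 / real N) sequentially"
      using close by (intro eventually_mono[OF eventually_ge_at_top[of 1]]) (simp add: S_def less_imp_le)
    show "(\<lambda>N. 1 / real N) \<longlonglongrightarrow> 0" by (rule lim_1_over_n)
  qed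
  from tendsto_add[OF blinfun.tendsto[OF this tendsto_const[of v]] Ev]
  have "(\<lambda>N. S (p N) v) \<longlonglongrightarrow> v" by (simp add: blinfun.diff_left)
  then have sub: "(\<lambda>N. a (p N)) \<longlonglongrightarrow> ip v v"
    unfolding a_eq by (intro ip.tendsto tendsto_const)
  \<comment> \<open>The value \<open>p 1\<close> may be 0 here; the bound still makes
    \<open>p\<close> unbounded.\<close>
  have p_ge: "N \<le> Suc (p N)" if "N \<ge> 1" for N
    using that
  proof (induction N rule: dec_induct)
    case (step N)
    then show ?case using strict_mono_onD[OF p, of N "Suc N"] by simp
  qed simp
  have "a \<longlonglongrightarrow> ip v v"
  proof (rule LIMSEQ_I)
    fix e :: real assume e: "e > 0"
    then obtain M where M: "\<And>N. N \<ge> M \<Longrightarrow> norm (a (p N) - ip v v) < e / 3"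
      using LIMSEQ_D[OF sub, of "e / 3"] by auto
    define m where "m = max M 1"
    show "\<exists>n0. \<forall>n\<ge>n0. norm (a n - ip v v) < e"
    proof (intro exI allI impI)
      fix n assume n: "n \<ge> p m"
      \<comment> \<open>Chosen so that \<open>n\<close> lies between \<open>p m\<close> and
        \<open>p k\<close> while \<open>k\<close> is also beyond \<open>M\<close>.\<close>
      define k where "k = Suc n + m"
      have "m \<ge> M" "k \<ge> M" by (simp_all add: k_def m_def)
      have "n \<le> p k" using p_ge[of k] by (simp add: k_def)
      then have "norm (a n - a (p m)) \<le> norm (a (p k) - a (p m))" using n by (intro mono)
      also have "\<dots> \<le> norm (a (p k) - ip v v) + norm (a (p m) - ip v v)"
        using norm_triangle_ineq4[of "a (p k) - ip v v" "a (p m) - ip v v"] by simp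
      finally have "norm (a n - a (p m)) < 2 * e / 3"
        using M[of k] M[of m] \<open>m \<ge> M\<close> \<open>k \<ge> M\<close> by linarith
      then show "norm (a n - ip v v) < e"
        using M[of m] \<open>m \<ge> M\<close> norm_triangle_ineq[of "a n - a (p m)" "a (p m) - ip v v"] by simp
    qed
  qed
  moreover have "(\<Sum>i<n. f (Suc i)) = a n" for n
    unfolding a_def by (induction n) simp_all
  ultimately show "(\<lambda>n. ip v (x (Suc n)) * ip (x (Suc n)) v) sums ip v v"
    by (simp add: sums_def f_def)
qed

end

theorem theorem2p8:
  fixes act :: "'x::{complex_normed_vector,banach} \<Rightarrow> 'a::cstar_algebra \<Rightarrow> 'x"
    and ip :: "'x \<Rightarrow> 'x \<Rightarrow> 'a"
    and E :: "nat \<Rightarrow> 'x \<Rightarrow>\<^sub>L 'x"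
  assumes "hilbert_module act ip"
    and "increasing_approx_unit act ip E"
  shows
    "(\<exists>(x :: nat \<Rightarrow> 'x) (p :: nat \<Rightarrow> nat).
        1 \<le> p 1 \<and> strict_mono_on {1..} p \<and>
        (\<forall>N\<ge>1. compact_le act ip (\<Sum>n=1..p N. theta act ip (x n) (x n)) (E N) \<and>
                norm ((\<Sum>n=1..p N. theta act ip (x n) (x n)) - E N) < 1 / real N)) \<and>
     (\<forall>x :: nat \<Rightarrow> 'x.
        (\<exists>p :: nat \<Rightarrow> nat.
          1 \<le> p 1 \<and> strict_mono_on {1..} p \<and>
          (\<forall>N\<ge>1. compact_le act ip (\<Sum>n=1..p N. theta act ip (x n) (x n)) (E N) \<and>
                  norm ((\<Sum>n=1..p N. theta act ip (x n) (x n)) - E N) < 1 / real N)) \<longrightarrow>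
        parseval_frame ip x)"
proof -
  interpret hilbert_module act ip by (rule assms(1))
  show ?thesis
    using approx_unit_frame_exists[OF assms(2)] approx_unit_parseval_frame[OF assms(2)] by blast
qed

end
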